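(* Let $n\ge 2$ and $0\le m\le n$ be fixed integers, and let $\Omega=\{(x,t): 0<x<1,\ 0<t<\infty\}$. Consider the initial boundary value problem $$\partial_t u_j+a_j(x,t)\partial_x u_j+\sum_{k=1}^n b_{jk}(x,t)u_k+\sum_{k=1}^n\int_0^x g_{jk}(y,t)u_k(y,t)\,dy=f_j(x,t),\quad (x,t)\in(0,1)\times(0,\infty),\ j\le n,$$ $$u_j(x,0)=\varphi_j(x),\quad x\in[0,1],\ j\le n,$$ $$u_j(0,t)=\sum_{k=1}^n\int_0^1 r_{jk}(x,t)u_k(x,t)\,dx,\quad t\in[0,\infty),\ 1\le j\le m,$$ $$u_j(1,t)=\sum_{k=1}^n\int_0^1 r_{jk}(x,t)u_k(x,t)\,dx,\quad t\in[0,\infty),\ m<j\le n,$$ with arbitrary initial data $\varphi_j\in L^2(0,1)$, $j\le n$. Suppose that the following conditions are fulfilled: (i) $\inf_{(x,t)\in\overline\Omega} a_j>0$ for all $j\le m$ and $\sup_{(x,t)\in\overline\Omega} a_j<0$ for all $j>m$; (ii) $a_j, b_{jk}\in C^1(\overline\Omega)$ and $g_{jk}, r_{jk}\in C^{0,1}_{x,t}(\overline\Omega)$ for all $j,k\le n$; (iii) for all $1\le j\ne k\le n$ there exists $\beta_{jk}\in C^1(\overline\Omega)$ such that $b_{jk}=\beta_{jk}(a_k-a_j)$. Then the $L^2$-generalized solution to this problem is eventually smoothing.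
   Context: Function classes: $C^1(\overline\Omega)$ denotes the functions continuously differentiable in $(x,t)$ up to the boundary of $\overline\Omega=[0,1]\times[0,\infty)$. $C^{0,1}_{x,t}(\overline\Omega)$ denotes the functions of $(x,t)$ that are continuous on $\overline\Omega$ together with their partial derivative in $t$. $L^2(0,1)^n$ is the vector space of functions $u=(u_1,\dots,u_n)$ with $u_j\in L^2(0,1)$. $L^2$-generalized solution: fix arbitrary $\varphi_j\in L^2(0,1)$ and sequences $\varphi_j^l\in C_0^\infty([0,1])$ (smooth, compactly supported functions) such that $\varphi_j^l\to\varphi_j$ in $L^2(0,1)$ as $l\to\infty$, for $j\le n$. For each $l\in\mathbb N$, the problem with $\varphi_j$ replaced by $\varphi_j^l$ has a unique classical solution, denoted $u^l$; the source takes the initial data $\varphi_j^l$, being compactly supported, to satisfy the zero order and first order compatibility conditions between the initial conditions and the boundary conditions. There exists a unique vector function $u\in C([0,\infty),L^2(0,1))^n$ such that $\|u(\cdot,\theta)-u^l(\cdot,\theta)\|_{L^2(0,1)^n}\to0$ as $l\to\infty$, uniformly in $\theta$ varying in the range $0\le\theta\le t$, for every $t>0$. This $u$ is called the $L^2$-generalized solution to the problem. Eventually smoothing: the $L^2$-generalized solution $u$ is called eventually smoothing if there is $d>0$ such that $u$ is a continuous vector function (of $(x,t)$) after the time $t\ge d$. *)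

theory Defs
  imports "HOL-Analysis.Analysis"
begin

text \<open>
  Points of the space-time domain are pairs (x, t).  Vectors with n components are functions on
  nat that are only looked at on the indices 1, ..., n.
\<close>

definition Omega :: "(real \<times> real) set" where
  "Omega = {0<..<1} \<times> {0<..}"

definition Omega_bar :: "(real \<times> real) set" where
  "Omega_bar = {0..1} \<times> {0..}"

definition C1_Omega_bar :: "(real \<times> real \<Rightarrow> real) set" where
  "C1_Omega_bar = {v. \<exists>vx vt. continuous_on Omega_bar vx \<and> continuous_on Omega_bar vt \<and>
     (\<forall>p\<in>Omega_bar. (v has_derivative (\<lambda>(h, k). vx p * h + vt p * k)) (at p within Omega_bar))}"

definition C01_Omega_bar :: "(real \<times> real \<Rightarrow> real) set" where
  "C01_Omega_bar = {v. continuous_on Omega_bar v \<and>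
     (\<exists>vt. continuous_on Omega_bar vt \<and>
       (\<forall>x\<in>{0..1}. \<forall>t\<in>{0..}. ((\<lambda>s. v (x, s)) has_real_derivative vt (x, t)) (at t within {0..})))}"

text \<open>Elements of L2(0,1) are represented by functions, without passing to the quotient modulo
  equality almost everywhere.\<close>

definition L2_space :: "(real \<Rightarrow> real) set" where
  "L2_space = {v. v \<in> borel_measurable (lebesgue_on {0<..<1}) \<and>
     integrable (lebesgue_on {0<..<1}) (\<lambda>x. (v x)\<^sup>2)}"

definition L2_norm_vec :: "nat \<Rightarrow> (nat \<Rightarrow> real \<Rightarrow> real) \<Rightarrow> real" where
  "L2_norm_vec n v = sqrt (\<Sum>j=1..n. \<integral>x. (v j x)\<^sup>2 \<partial>lebesgue_on {0<..<1})"

text \<open>The space C([0,\<infinity>), L2(0,1)), to the power n; here u j t is the function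
  u_j( . , t).\<close>

definition C_L2_vec :: "nat \<Rightarrow> (nat \<Rightarrow> real \<Rightarrow> real \<Rightarrow> real) set" where
  "C_L2_vec n = {u. (\<forall>j\<in>{1..n}. \<forall>t\<ge>0. u j t \<in> L2_space) \<and>
     (\<forall>t\<ge>0. ((\<lambda>s. L2_norm_vec n (\<lambda>j x. u j s x - u j t x)) \<longlongrightarrow> 0) (at t within {0..}))}"

definition C_infinity_01 :: "(real \<Rightarrow> real) set" where
  "C_infinity_01 = {v. \<exists>D. (\<forall>x\<in>{0..1}. D 0 x = v x) \<and>
     (\<forall>i::nat. \<forall>x\<in>{0..1}. (D i has_real_derivative D (Suc i) x) (at x within {0..1}))}"

definition C0_infinity_01 :: "(real \<Rightarrow> real) set" where
  "C0_infinity_01 = {v \<in> C_infinity_01. \<exists>K. compact K \<and> K \<subseteq> {0<..<1} \<and> (\<forall>x\<in>{0..1} - K. v x = 0)}"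

definition classical_solution ::
  "nat \<Rightarrow> nat \<Rightarrow> (nat \<Rightarrow> real \<times> real \<Rightarrow> real) \<Rightarrow> (nat \<Rightarrow> nat \<Rightarrow> real \<times> real \<Rightarrow> real) \<Rightarrow>
   (nat \<Rightarrow> nat \<Rightarrow> real \<times> real \<Rightarrow> real) \<Rightarrow> (nat \<Rightarrow> nat \<Rightarrow> real \<times> real \<Rightarrow> real) \<Rightarrow>
   (nat \<Rightarrow> real \<times> real \<Rightarrow> real) \<Rightarrow> (nat \<Rightarrow> real \<Rightarrow> real) \<Rightarrow> (nat \<Rightarrow> real \<times> real \<Rightarrow> real) \<Rightarrow> bool"
where
  "classical_solution n m a b g r f \<phi> u \<longleftrightarrow>
     (\<forall>j\<in>{1..n}. u j \<in> C1_Omega_bar) \<and>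
     (\<forall>j\<in>{1..n}. \<forall>(x, t)\<in>Omega.
        deriv (\<lambda>s. u j (x, s)) t + a j (x, t) * deriv (\<lambda>y. u j (y, t)) x
        + (\<Sum>k=1..n. b j k (x, t) * u k (x, t))
        + (\<Sum>k=1..n. integral {0..x} (\<lambda>y. g j k (y, t) * u k (y, t)))
        = f j (x, t)) \<and>
     (\<forall>j\<in>{1..n}. \<forall>x\<in>{0..1}. u j (x, 0) = \<phi> j x) \<and>
     (\<forall>j\<in>{1..m}. \<forall>t\<ge>0.
        u j (0, t) = (\<Sum>k=1..n. integral {0..1} (\<lambda>x. r j k (x, t) * u k (x, t)))) \<and>
     (\<forall>j\<in>{m<..n}. \<forall>t\<ge>0.
        u j (1, t) = (\<Sum>k=1..n. integral {0..1} (\<lambda>x. r j k (x, t) * u k (x, t))))"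

text \<open>
  The set A is the class from which the components of the approximating initial data are taken.
  Zero and first order compatibility of the approximating data with the boundary conditions is not
  listed separately: it is enforced by the existence of classical solutions (continuously
  differentiable up to the boundary) for these data.

  For A = C0_infinity_01 the definition is the one of the source.  For integral boundary conditions
  compact support in (0,1) does not imply compatibility: at time 0 it leaves the requirement that
  the sum over k of the integrals of r_jk(x,0) phi_k(x) be zero, and this passes to L2 limits.  So
  with A = C0_infinity_01 not every initial datum in L2 can be approximated; A = C_infinity_01
  removes this restriction.
\<close>

definition L2_generalized_solution ::
  "(real \<Rightarrow> real) set \<Rightarrow>
   nat \<Rightarrow> nat \<Rightarrow> (nat \<Rightarrow> real \<times> real \<Rightarrow> real) \<Rightarrow> (nat \<Rightarrow> nat \<Rightarrow> real \<times> real \<Rightarrow> real) \<Rightarrow>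
   (nat \<Rightarrow> nat \<Rightarrow> real \<times> real \<Rightarrow> real) \<Rightarrow> (nat \<Rightarrow> nat \<Rightarrow> real \<times> real \<Rightarrow> real) \<Rightarrow>
   (nat \<Rightarrow> real \<times> real \<Rightarrow> real) \<Rightarrow> (nat \<Rightarrow> real \<Rightarrow> real) \<Rightarrow> (nat \<Rightarrow> real \<Rightarrow> real \<Rightarrow> real) \<Rightarrow> bool"
where
  "L2_generalized_solution A n m a b g r f \<phi> u \<longleftrightarrow>
     u \<in> C_L2_vec n \<and>
     (\<exists>\<Phi> U.
        (\<forall>l::nat. \<forall>j\<in>{1..n}. \<Phi> l j \<in> A) \<and>
        (\<lambda>l. L2_norm_vec n (\<lambda>j x. \<Phi> l j x - \<phi> j x)) \<longlonglongrightarrow> 0 \<and>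
        (\<forall>l. classical_solution n m a b g r f (\<Phi> l) (U l)) \<and>
        (\<forall>t>0. uniform_limit {0..t} (\<lambda>l \<theta>. L2_norm_vec n (\<lambda>j x. u j \<theta> x - U l j (x, \<theta>)))
                 (\<lambda>_. 0) sequentially))"

text \<open>Since u j t is only determined up to a null set, continuity of u after the time d means that
  u has a representative v that is continuous in (x, t) jointly.\<close>

definition eventually_smoothing :: "nat \<Rightarrow> (nat \<Rightarrow> real \<Rightarrow> real \<Rightarrow> real) \<Rightarrow> bool" where
  "eventually_smoothing n u \<longleftrightarrow>
     (\<exists>d>0. \<exists>v :: nat \<Rightarrow> real \<times> real \<Rightarrow> real. \<forall>j\<in>{1..n}.
        continuous_on ({0..1} \<times> {d..}) (v j) \<and>
        (\<forall>t\<ge>d. AE x in lebesgue_on {0<..<1}. u j t x = v j (x, t)))"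

end

theory Submission
  imports Defs
begin

text \<open>
  The generalized solution is a limit of classical solutions, uniformly in time on bounded time
  intervals with respect to the L2 norm in x.  Hence it is enough to bound classical solutions w of
  the problem without forcing, after a fixed time d, in the supremum norm by N, the supremum over the
  times up to T of the L1 norms in x.  Applied to the differences of the approximating solutions, this
  shows that they converge uniformly on \<open>[0,1] \<times> [d,T]\<close> for every T, and the
  continuous limit represents the generalized solution.

  Everything in the j-th equation that is integrated in x is bounded by N, and so is every boundary
  value, because the boundary conditions are integrals of w.  The only obstruction are the terms
  \<open>b j k * w k\<close> with k different from j, taken at a point.  Let P be the integral of
  \<open>w k\<close> from the end of the interval where the k-th component enters up to x.  The k-th
  equation, written as a conservation law, shows that the derivative of P along the
  characteristics of the j-th equation is \<open>(a j - a k) * w k\<close> plus terms bounded by N.  Since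
  \<open>b j k = \<beta> j k * (a k - a j)\<close>, the function obtained from \<open>w j\<close> by subtracting
  \<open>\<beta> j k * P\<close> for each such k satisfies a scalar transport equation with a right-hand side
  bounded by N (\<open>compensated_transport\<close>, \<open>residual_bound\<close>), and it differs from
  \<open>w j\<close> by at most a multiple of N.  This is where the assumption on the coefficients b
  enters.

  The speeds are bounded away from 0 by some \<open>\<alpha>\<close>, so after the time \<open>1 / \<alpha>\<close>
  every characteristic traced backwards has met the end where its component enters, and the solution
  is determined by boundary values, which are bounded by N, and no longer by the initial values
  directly.  This is expressed by a maximum principle on the region that the boundary values
  determine (\<open>transport_maximum_principle\<close>), which avoids the construction of the
  characteristics.  Together these facts give \<open>smoothing_estimate\<close>.
\<close>

section \<open>Functions on the closed half-strip\<close>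

lemma Omega_bar_iff: "(x, t) \<in> Omega_bar \<longleftrightarrow> 0 \<le> x \<and> x \<le> 1 \<and> 0 \<le> t"
  by (auto simp: Omega_bar_def)

lemma continuous_on_Omega_bar_slice:
  assumes "continuous_on Omega_bar v" and "0 \<le> t"
  shows "continuous_on {0..1} (\<lambda>x. v (x, t))"
  using assms(2) by (auto intro!: continuous_on_compose2[OF assms(1)] continuous_intros simp: Omega_bar_iff)

lemma has_derivative_Omega_bar_slices:
  assumes "\<And>p. p \<in> Omega_bar \<Longrightarrow> (v has_derivative (\<lambda>(h, k). vx p * h + vt p * k)) (at p within Omega_bar)"
    and "(x, t) \<in> Omega_bar"
  shows "((\<lambda>y. v (y, t)) has_real_derivative vx (x, t)) (at x within {0..1})"
    and "((\<lambda>s. v (x, s)) has_real_derivative vt (x, t)) (at t within {0..})"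
proof -
  have "((\<lambda>y. v (y, t)) has_derivative (\<lambda>h. (\<lambda>(h, k). vx (x, t) * h + vt (x, t) * k) (h, 0))) (at x within {0..1})"
    by (rule has_derivative_in_compose2[OF assms(1), where f="\<lambda>y. (y, t)"])
      (use assms(2) in \<open>auto simp: Omega_bar_iff intro!: derivative_eq_intros\<close>)
  then show "((\<lambda>y. v (y, t)) has_real_derivative vx (x, t)) (at x within {0..1})"
    by (simp add: has_field_derivative_def)
  have "((\<lambda>s. v (x, s)) has_derivative (\<lambda>k. (\<lambda>(h, k). vx (x, t) * h + vt (x, t) * k) (0, k))) (at t within {0..})"
    by (rule has_derivative_in_compose2[OF assms(1), where f="\<lambda>s. (x, s)"])
      (use assms(2) in \<open>auto simp: Omega_bar_iff intro!: derivative_eq_intros\<close>)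
  then show "((\<lambda>s. v (x, s)) has_real_derivative vt (x, t)) (at t within {0..})"
    by (simp add: has_field_derivative_def)
qed

text \<open>
  The partial derivative in x is the integrand at the endpoint and is jointly continuous, so it is
  enough to know the partial derivative in t at the given point alone.  This is why the theorem on
  partial derivatives is applied with the order of the variables exchanged.
\<close>

lemma has_derivative_space_primitive:
  assumes w: "\<And>p. p \<in> Omega_bar \<Longrightarrow> (w has_derivative (\<lambda>(h, k). wx p * h + wt p * k)) (at p within Omega_bar)"
    and wt: "continuous_on Omega_bar wt"
    and p: "(x, t) \<in> Omega_bar"
  shows "((\<lambda>q. integral {0..fst q} (\<lambda>y. w (y, snd q))) has_derivative
           (\<lambda>(h, k). w (x, t) * h + integral {0..x} (\<lambda>y. wt (y, t)) * k)) (at (x, t) within Omega_bar)"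
proof -
  have wc: "continuous_on Omega_bar w"
    using w by (meson differentiable_imp_continuous_on differentiable_on_def differentiableI)
  have x: "0 \<le> x" "x \<le> 1" and t: "0 \<le> t" using p by (auto simp: Omega_bar_iff)
  define f where "f s z = integral {0..z} (\<lambda>y. w (y, s))" for s z
  have 1: "((\<lambda>s. f s x) has_derivative (\<lambda>k. integral {0..x} (\<lambda>y. wt (y, t)) * k)) (at t within {0..})"
    unfolding f_def has_field_derivative_def[symmetric]
  proof (rule leibniz_rule_field_derivative[where fx="\<lambda>s y. wt (y, s)" and a=0 and b=x, unfolded cbox_interval])
    show "((\<lambda>s. w (y, s)) has_real_derivative wt (y, s)) (at s within {0..})"
      if "s \<in> {0..}" "y \<in> {0..x}" for s y
      by (rule has_derivative_Omega_bar_slices(2)[OF w]) (use that x in \<open>auto simp: Omega_bar_iff\<close>)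
    show "(\<lambda>y. w (y, s)) integrable_on {0..x}" if "s \<in> {0..}" for s
      by (rule integrable_continuous_real, rule continuous_on_subset[OF continuous_on_Omega_bar_slice[OF wc]])
        (use that x in auto)
    show "continuous_on ({0..} \<times> {0..x}) (\<lambda>(s, y). wt (y, s))"
      unfolding split_beta
      by (rule continuous_on_compose2[OF wt]) (use x in \<open>auto intro!: continuous_intros simp: Omega_bar_iff\<close>)
  qed (use t in auto)
  have 2: "((\<lambda>z. f s z) has_derivative blinfun_apply (blinfun_mult_right (w (z, s)))) (at z within {0..1})"
    if "s \<in> {0..}" "z \<in> {0..1}" for s z
    using integral_has_real_derivative[OF continuous_on_Omega_bar_slice[OF wc], of s z] that
    by (simp add: f_def has_field_derivative_def)
  have 3: "continuous (at (t, x) within {0..} \<times> {0..1}) (\<lambda>(s, z). blinfun_mult_right (w (z, s)))"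
  proof -
    have "continuous_on ({0..} \<times> {0..1}) (\<lambda>q. w (snd q, fst q))"
      by (rule continuous_on_compose2[OF wc]) (auto intro!: continuous_intros simp: Omega_bar_iff)
    then have "continuous_on ({0..} \<times> {0..1}) (\<lambda>q. blinfun_mult_right (w (snd q, fst q)))"
      by (intro continuous_intros bounded_linear.continuous_on[OF bounded_linear_blinfun_mult_right])
    then show ?thesis
      using x t by (auto simp: continuous_on_eq_continuous_within case_prod_unfold)
  qed
  have "((\<lambda>(s, z). f s z) has_derivative
      (\<lambda>(k, h). integral {0..x} (\<lambda>y. wt (y, t)) * k + blinfun_mult_right (w (x, t)) h)) (at (t, x) within {0..} \<times> {0..1})"
    by (rule has_derivative_partialsI[OF 1 2 3]) (use x in auto)
  then have 4: "((\<lambda>q. f (fst q) (snd q)) has_derivative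
      (\<lambda>(k, h). integral {0..x} (\<lambda>y. wt (y, t)) * k + w (x, t) * h)) (at (t, x) within {0..} \<times> {0..1})"
    by (simp add: case_prod_unfold)
  have sw: "(prod.swap has_derivative prod.swap) (at (x, t) within Omega_bar)"
    unfolding prod.swap_def[abs_def] by (auto intro!: derivative_eq_intros)
  have img: "prod.swap ` Omega_bar \<subseteq> {0..} \<times> {0..1}" by (auto simp: Omega_bar_def)
  have "((\<lambda>q. f (fst (prod.swap q)) (snd (prod.swap q))) has_derivative
      (\<lambda>q. (\<lambda>(k, h). integral {0..x} (\<lambda>y. wt (y, t)) * k + w (x, t) * h) (prod.swap q))) (at (x, t) within Omega_bar)"
    by (rule has_derivative_in_compose[OF sw has_derivative_subset[OF _ img]])  (use 4 in simp)
  then show ?thesis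
    unfolding f_def fst_swap snd_swap by (rule has_derivative_eq_rhs) (auto simp: fun_eq_iff)
qed

section \<open>A maximum principle for the scalar transport equation\<close>

text \<open>
  In place of solving the ordinary differential equation of the characteristics, the equation is
  tested at a maximum point of the weighted function over a region K.  The factor (1 - 2 x0) turns
  the speed into its component pointing away from the inlet x0, so characteristics run away from x0
  at least at the speed \<open>\<alpha>\<close>.  Hence a characteristic that passes through a point of K
  stays in K backwards in time until it meets the side x = x0, and the values of Z at time 0 away
  from the inlet have no influence on K.  Since the weight \<open>exp (- (M + 1) t)\<close> makes the
  coefficient of Z in the equation at least 1, a maximum exceeding C away from the inlet would have
  larger values of the weighted function right behind it.
\<close>

lemma transport_maximum_principle:
  fixes Z c R av Zx Zt :: "real \<times> real \<Rightarrow> real" and x0 \<alpha> M C T :: real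
  defines "K \<equiv> {(x, t). 0 \<le> x \<and> x \<le> 1 \<and> 0 \<le> t \<and> t \<le> T \<and> \<bar>x - x0\<bar> \<le> \<alpha> * t}"
  assumes x0: "x0 \<in> {0, 1}" and \<alpha>: "0 < \<alpha>" and C: "0 \<le> C" and M: "0 \<le> M"
    and der: "\<And>p. p \<in> Omega_bar \<Longrightarrow> (Z has_derivative (\<lambda>(h, k). Zx p * h + Zt p * k)) (at p within Omega_bar)"
    and speed: "\<And>p. p \<in> K \<Longrightarrow> \<alpha> \<le> (1 - 2 * x0) * av p"
    and eq: "\<And>p. p \<in> K \<Longrightarrow> 0 < snd p \<Longrightarrow> Zt p + av p * Zx p = R p - c p * Z p"
    and bounds: "\<And>p. p \<in> K \<Longrightarrow> \<bar>c p\<bar> \<le> M" "\<And>p. p \<in> K \<Longrightarrow> 0 < snd p \<Longrightarrow> \<bar>R p\<bar> \<le> C"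
    and inlet: "\<And>t. 0 \<le> t \<Longrightarrow> t \<le> T \<Longrightarrow> Z (x0, t) \<le> C"
    and p: "p \<in> K"
  shows "Z p \<le> C * exp ((M + 1) * T)"
proof -
  define Y where "Y q = exp (- (M + 1) * snd q) * Z q" for q
  have Zc: "continuous_on Omega_bar Z"
    using der by (meson differentiable_imp_continuous_on differentiable_on_def differentiableI)
  have KO: "K \<subseteq> Omega_bar" by (auto simp: K_def Omega_bar_def)
  have "compact K"
  proof -
    have "closed {q::real \<times> real. \<bar>fst q - x0\<bar> \<le> \<alpha> * snd q}"
      by (intro closed_Collect_le continuous_intros)
    moreover have "K = ({0..1} \<times> {0..T}) \<inter> {q. \<bar>fst q - x0\<bar> \<le> \<alpha> * snd q}"
      by (auto simp: K_def)
    ultimately show ?thesis by (simp add: compact_Int_closed compact_Times)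
  qed
  moreover have "continuous_on K Y"
    unfolding Y_def by (intro continuous_intros continuous_on_subset[OF Zc KO])
  ultimately obtain q where q: "q \<in> K" and max: "\<And>q'. q' \<in> K \<Longrightarrow> Y q' \<le> Y q"
    using continuous_attains_sup[of K Y] p by blast
  obtain x t where qxt: "q = (x, t)" by (cases q)
  have xt: "0 \<le> x" "x \<le> 1" "0 \<le> t" "t \<le> T" "\<bar>x - x0\<bar> \<le> \<alpha> * t"
    using q by (auto simp: K_def qxt)
  have "Z q \<le> C"
  proof (cases "x = x0")
    case True
    then show ?thesis using inlet[of t] xt by (simp add: qxt)
  next
    case False
    show ?thesis
    proof (rule ccontr)
      assume "\<not> Z q \<le> C"
      then have ZC: "C < Z q" by simp
      define A where "A = av q"
      have A: "\<alpha> \<le> (1 - 2 * x0) * A" using speed[OF q] by (simp add: A_def)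
      have tpos: "0 < t" using xt False \<alpha> by (smt (verit) mult_nonneg_nonpos)
      define \<delta> where "\<delta> = min t (\<bar>x - x0\<bar> / \<bar>A\<bar>)"
      have Apos: "\<bar>A\<bar> = (1 - 2 * x0) * A" "0 < \<bar>A\<bar>" using A x0 \<alpha> by auto
      have \<delta>: "0 < \<delta>" using tpos False Apos by (simp add: \<delta>_def)
      \<comment> \<open>The straight line through q with the direction of the characteristic stays in K for a
        while when followed backwards, so Y can be compared with its maximum along this line.\<close>
      have upstream: "(x - s * A, t - s) \<in> K" if s: "s \<in> {0..\<delta>}" for s
      proof -
        have s': "0 \<le> s" "s \<le> t" "s * \<bar>A\<bar> \<le> \<bar>x - x0\<bar>"
          using s Apos(2) by (auto simp: \<delta>_def le_divide_eq)
        have "s * \<alpha> \<le> s * \<bar>A\<bar>" using A Apos s'(1) by (intro mult_left_mono) auto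
        moreover have "0 \<le> s * \<bar>A\<bar>" "0 \<le> s * \<alpha>" using s'(1) \<alpha> by simp_all
        ultimately show ?thesis
          using s' xt Apos(1) x0 by (auto simp: K_def algebra_simps)
      qed
      have line: "((\<lambda>s. Z (x - s * A, t - s)) has_derivative
          (\<lambda>s. (\<lambda>(h, k). Zx (x, t) * h + Zt (x, t) * k) (- s * A, - s))) (at 0 within {0..\<delta>})"
      proof (rule has_derivative_in_compose2[where f="\<lambda>s. (x - s * A, t - s)" and t=Omega_bar and x=0, OF der, simplified])
        show "(\<lambda>s. (x - s * A, t - s)) ` {0..\<delta>} \<subseteq> Omega_bar" using upstream KO by auto
      qed (use \<delta> in \<open>auto intro!: derivative_eq_intros\<close>)
      have "(\<lambda>s. (\<lambda>(h, k). Zx (x, t) * h + Zt (x, t) * k) (- s * A, - s)) = (*) (- (Zt q + A * Zx q))"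
        by (auto simp: qxt algebra_simps)
      then have "((\<lambda>s. Z (x - s * A, t - s)) has_real_derivative (- (Zt q + A * Zx q))) (at 0 within {0..\<delta>})"
        using line by (simp add: has_field_derivative_def)
      then have "((\<lambda>s. Y (x - s * A, t - s)) has_real_derivative
          exp (- (M + 1) * t) * ((M + 1) * Z q - (Zt q + A * Zx q))) (at 0 within {0..\<delta>})"
        unfolding Y_def snd_conv
        by (auto intro!: derivative_eq_intros simp: qxt algebra_simps)
      moreover have "0 < exp (- (M + 1) * t) * ((M + 1) * Z q - (Zt q + A * Zx q))"
      proof -
        have "Zt q + A * Zx q = R q - c q * Z q" using eq[OF q] tpos by (simp add: A_def qxt)
        moreover have "- c q * Z q \<le> M * Z q"
          using bounds(1)[OF q] ZC C by (intro mult_right_mono) auto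
        moreover have "R q < Z q" using bounds(2)[OF q] tpos ZC by (simp add: qxt)
        ultimately have "0 < (M + 1) * Z q - (Zt q + A * Zx q)" by (simp add: algebra_simps)
        then show ?thesis by simp
      qed
      ultimately obtain d where d: "d > 0" "\<And>h. h > 0 \<Longrightarrow> 0 + h \<in> {0..\<delta>} \<Longrightarrow> h < d \<Longrightarrow>
          Y (x - 0 * A, t - 0) < Y (x - (0 + h) * A, t - (0 + h))"
        by (blast dest: has_real_derivative_pos_inc_right)
      define h where "h = min \<delta> (d / 2)"
      have "Y q < Y (x - h * A, t - h)" using d(2)[of h] d(1) \<delta> by (auto simp: h_def qxt)
      moreover have "Y (x - h * A, t - h) \<le> Y q" using d(1) \<delta> by (intro max upstream) (auto simp: h_def)
      ultimately show False by simp
    qed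
  qed
  obtain x' t' where pxt: "p = (x', t')" by (cases p)
  have t': "0 \<le> t'" "t' \<le> T" using p by (auto simp: K_def pxt)
  have "- (M + 1) * t \<le> 0"
    using M xt by (intro mult_nonpos_nonneg) auto
  have "Y q \<le> exp (- (M + 1) * t) * C"
    unfolding Y_def using \<open>Z q \<le> C\<close> by (simp add: qxt)
  also have "\<dots> \<le> 1 * C"
    using C \<open>- (M + 1) * t \<le> 0\<close> by (intro mult_right_mono) (simp_all only: exp_le_one_iff)
  finally have "exp (- (M + 1) * t') * Z p \<le> C"
    using max[OF p] by (simp add: Y_def pxt)
  then have "exp ((M + 1) * t') * (exp (- (M + 1) * t') * Z p) \<le> exp ((M + 1) * t') * C"
    by (intro mult_left_mono) auto
  moreover have "exp ((M + 1) * t') * (exp (- (M + 1) * t') * Z p) = Z p"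
    by (simp add: algebra_simps flip: exp_add mult.assoc)
  moreover have "exp ((M + 1) * t') * C \<le> exp ((M + 1) * T) * C"
    using M t' C by (intro mult_right_mono) (auto intro!: mult_left_mono)
  ultimately show ?thesis by (metis mult.commute order_trans)
qed

section \<open>The system and its compensated components\<close>

text \<open>
  The data of the problem on the slab of the times up to T, with the coupling assumption on the
  coefficients b resolved.  The number M may depend on T, but the lower bound \<open>\<alpha>\<close> for the speeds does not: it determines the smoothing time.
\<close>

locale transport_system =
  fixes n m :: nat
    and a ax :: "nat \<Rightarrow> real \<times> real \<Rightarrow> real"
    and b g r \<beta> \<beta>x \<beta>t :: "nat \<Rightarrow> nat \<Rightarrow> real \<times> real \<Rightarrow> real"
    and \<alpha> M T :: real
  assumes mn: "m \<le> n"
    and T: "0 < T"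
    and \<alpha>: "0 < \<alpha>"
    and speed_left: "\<And>j p. j \<in> {1..m} \<Longrightarrow> p \<in> Omega_bar \<Longrightarrow> \<alpha> \<le> a j p"
    and speed_right: "\<And>j p. j \<in> {m<..n} \<Longrightarrow> p \<in> Omega_bar \<Longrightarrow> a j p \<le> - \<alpha>"
    and a_cont: "\<And>j. j \<in> {1..n} \<Longrightarrow> continuous_on Omega_bar (a j)"
    and ax_cont: "\<And>j. j \<in> {1..n} \<Longrightarrow> continuous_on Omega_bar (ax j)"
    and a_deriv: "\<And>j x t. j \<in> {1..n} \<Longrightarrow> (x, t) \<in> Omega_bar \<Longrightarrow>
        ((\<lambda>y. a j (y, t)) has_real_derivative ax j (x, t)) (at x within {0..1})"
    and b_cont: "\<And>j k. j \<in> {1..n} \<Longrightarrow> k \<in> {1..n} \<Longrightarrow> continuous_on Omega_bar (b j k)"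
    and g_cont: "\<And>j k. j \<in> {1..n} \<Longrightarrow> k \<in> {1..n} \<Longrightarrow> continuous_on Omega_bar (g j k)"
    and r_cont: "\<And>j k. j \<in> {1..n} \<Longrightarrow> k \<in> {1..n} \<Longrightarrow> continuous_on Omega_bar (r j k)"
    and \<beta>_deriv: "\<And>j k p. j \<in> {1..n} \<Longrightarrow> k \<in> {1..n} \<Longrightarrow> j \<noteq> k \<Longrightarrow> p \<in> Omega_bar \<Longrightarrow>
        (\<beta> j k has_derivative (\<lambda>(h, s). \<beta>x j k p * h + \<beta>t j k p * s)) (at p within Omega_bar)"
    and coupling: "\<And>j k p. j \<in> {1..n} \<Longrightarrow> k \<in> {1..n} \<Longrightarrow> j \<noteq> k \<Longrightarrow> p \<in> Omega_bar \<Longrightarrow>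
        b j k p = \<beta> j k p * (a k p - a j p)"
    and bound1: "\<And>j p. j \<in> {1..n} \<Longrightarrow> p \<in> {0..1} \<times> {0..T} \<Longrightarrow> \<bar>a j p\<bar> \<le> M \<and> \<bar>ax j p\<bar> \<le> M"
    and bound2: "\<And>j k p. j \<in> {1..n} \<Longrightarrow> k \<in> {1..n} \<Longrightarrow> p \<in> {0..1} \<times> {0..T} \<Longrightarrow>
        \<bar>b j k p\<bar> \<le> M \<and> \<bar>g j k p\<bar> \<le> M \<and> \<bar>r j k p\<bar> \<le> M"
    and bound3: "\<And>j k p. j \<in> {1..n} \<Longrightarrow> k \<in> {1..n} \<Longrightarrow> j \<noteq> k \<Longrightarrow> p \<in> {0..1} \<times> {0..T} \<Longrightarrow>
        \<bar>\<beta> j k p\<bar> \<le> M \<and> \<bar>\<beta>x j k p\<bar> \<le> M \<and> \<bar>\<beta>t j k p\<bar> \<le> M"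
begin

text \<open>
  The end of the interval at which the j-th component enters, that is, where its boundary condition
  is posed.
\<close>

definition inlet :: "nat \<Rightarrow> real" where
  "inlet j = (if j \<le> m then 0 else 1)"

lemma inlet_cases: "inlet j \<in> {0, 1}"
  by (simp add: inlet_def)

text \<open>
  In the transport equation of a compensated component, the integral terms contribute M N.  Each of the
  other components contributes \<open>(2 * M\<^sup>2 + M) * (2 * N)\<close> through its primitive, which is at
  most 2 N, and \<open>M * (6 * M * N + M\<^sup>2 * N)\<close> through its production and its inlet value.
\<close>

definition residual_const :: real where
  "residual_const = M + real n * (M ^ 3 + 10 * M\<^sup>2 + 2 * M)"

end

text \<open>
  A classical solution without forcing.  The number N bounds its mass, the L1 norm in x,
  uniformly in time up to T; all estimates below are linear in N, and no bound for the supremum of the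
  initial values enters them.
\<close>

locale homogeneous_solution = transport_system +
  fixes w wx wt :: "nat \<Rightarrow> real \<times> real \<Rightarrow> real" and N :: real
  assumes w_deriv: "\<And>j p. j \<in> {1..n} \<Longrightarrow> p \<in> Omega_bar \<Longrightarrow>
        (w j has_derivative (\<lambda>(h, k). wx j p * h + wt j p * k)) (at p within Omega_bar)"
    and wx_cont: "\<And>j. j \<in> {1..n} \<Longrightarrow> continuous_on Omega_bar (wx j)"
    and wt_cont: "\<And>j. j \<in> {1..n} \<Longrightarrow> continuous_on Omega_bar (wt j)"
    and pde_interior: "\<And>j x t. j \<in> {1..n} \<Longrightarrow> (x, t) \<in> Omega \<Longrightarrow>
        wt j (x, t) + a j (x, t) * wx j (x, t) + (\<Sum>k=1..n. b j k (x, t) * w k (x, t))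
        + (\<Sum>k=1..n. integral {0..x} (\<lambda>y. g j k (y, t) * w k (y, t))) = 0"
    and inlet_value: "\<And>j t. j \<in> {1..n} \<Longrightarrow> 0 \<le> t \<Longrightarrow>
        w j (inlet j, t) = (\<Sum>k=1..n. integral {0..1} (\<lambda>x. r j k (x, t) * w k (x, t)))"
    and mass: "\<And>t. t \<in> {0..T} \<Longrightarrow> (\<Sum>k=1..n. integral {0..1} (\<lambda>x. \<bar>w k (x, t)\<bar>)) \<le> N"
begin

lemma w_cont: "j \<in> {1..n} \<Longrightarrow> continuous_on Omega_bar (w j)"
  using w_deriv by (meson differentiable_imp_continuous_on differentiable_on_def differentiableI)

lemma N_nonneg: "0 \<le> N"
proof -
  have "0 \<le> (\<Sum>k=1..n. integral {0..1} (\<lambda>x. \<bar>w k (x, 0)\<bar>))"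
    by (intro sum_nonneg) (auto intro!: Henstock_Kurzweil_Integration.integral_nonneg
        integrable_continuous_real continuous_intros continuous_on_Omega_bar_slice w_cont)
  then show ?thesis using mass[of 0] T by simp
qed

lemma weighted_mass_bound:
  assumes c: "\<And>k. k \<in> {1..n} \<Longrightarrow> continuous_on {0..1} (c k)"
    and B: "\<And>k y. k \<in> {1..n} \<Longrightarrow> y \<in> {0..1} \<Longrightarrow> \<bar>c k y\<bar> \<le> B"
    and x: "x \<in> {0..1}" and t: "t \<in> {0..T}" and B0: "0 \<le> B"
  shows "\<bar>\<Sum>k=1..n. integral {0..x} (\<lambda>y. c k y * w k (y, t))\<bar> \<le> B * N"
proof -
  note slice = continuous_on_Omega_bar_slice[OF w_cont]
  have "\<bar>integral {0..x} (\<lambda>y. c k y * w k (y, t))\<bar> \<le> B * integral {0..1} (\<lambda>y. \<bar>w k (y, t)\<bar>)"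
    if k: "k \<in> {1..n}" for k
  proof -
    have cw: "continuous_on {0..1} (\<lambda>y. c k y * w k (y, t))"
      using t by (intro continuous_intros c slice k) auto
    have cB: "continuous_on {0..1} (\<lambda>y. B * \<bar>w k (y, t)\<bar>)"
      using t by (intro continuous_intros slice k) auto
    have sub: "{0..x} \<subseteq> {0..1}" using x by auto
    have "\<bar>integral {0..x} (\<lambda>y. c k y * w k (y, t))\<bar> \<le> integral {0..x} (\<lambda>y. B * \<bar>w k (y, t)\<bar>)"
      unfolding real_norm_def[symmetric]
      by (rule integral_norm_bound_integral)
        (use B[OF k] x in \<open>auto intro!: integrable_continuous_real continuous_on_subset[OF cw sub]
           continuous_on_subset[OF cB sub] mult_right_mono simp: abs_mult\<close>)
    also have "\<dots> \<le> integral {0..1} (\<lambda>y. B * \<bar>w k (y, t)\<bar>)"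
      by (rule integral_subset_le) (use B0 sub in \<open>auto intro!: integrable_continuous_real
           continuous_on_subset[OF cB sub] cB\<close>)
    finally show ?thesis by simp
  qed
  then have "\<bar>\<Sum>k=1..n. integral {0..x} (\<lambda>y. c k y * w k (y, t))\<bar>
      \<le> (\<Sum>k=1..n. B * integral {0..1} (\<lambda>y. \<bar>w k (y, t)\<bar>))"
    by (intro order_trans[OF sum_abs] sum_mono) auto
  also have "\<dots> \<le> B * N"
    unfolding sum_distrib_left[symmetric] using mass[OF t] B0 by (rule mult_left_mono)
  finally show ?thesis .
qed

lemma M_nonneg: "j \<in> {1..n} \<Longrightarrow> 0 \<le> M"
  using bound1[of j "(0, 0)"] T by auto

lemma inlet_bound:
  assumes j: "j \<in> {1..n}" and t: "t \<in> {0..T}"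
  shows "\<bar>w j (inlet j, t)\<bar> \<le> M * N"
proof -
  have "\<bar>\<Sum>k=1..n. integral {0..1} (\<lambda>x. r j k (x, t) * w k (x, t))\<bar> \<le> M * N"
    by (rule weighted_mass_bound) (use j t in \<open>auto intro!: continuous_on_Omega_bar_slice r_cont
      bound2[THEN conjunct2, THEN conjunct2] M_nonneg\<close>)
  then show ?thesis using inlet_value[OF j] t by simp
qed

lemma memory_bound:
  "j \<in> {1..n} \<Longrightarrow> x \<in> {0..1} \<Longrightarrow> t \<in> {0..T} \<Longrightarrow>
    \<bar>\<Sum>k=1..n. integral {0..x} (\<lambda>y. g j k (y, t) * w k (y, t))\<bar> \<le> M * N"
  by (intro weighted_mass_bound) (auto intro!: continuous_on_Omega_bar_slice g_cont
      bound2[THEN conjunct2, THEN conjunct1] M_nonneg)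

text \<open>
  The equation is given in the open strip only; both sides are continuous in x, which gives it at
  the two ends for every positive time.
\<close>

lemma pde_closed:
  assumes j: "j \<in> {1..n}" and x: "x \<in> {0..1}" and t: "0 < t"
  shows "wt j (x, t) + a j (x, t) * wx j (x, t) + (\<Sum>k=1..n. b j k (x, t) * w k (x, t))
        + (\<Sum>k=1..n. integral {0..x} (\<lambda>y. g j k (y, t) * w k (y, t))) = 0"
proof -
  have cl: "closure {0<..<1::real} = {0..1}" by simp
  have "continuous_on (closure {0<..<1}) (\<lambda>x. wt j (x, t) + a j (x, t) * wx j (x, t) + (\<Sum>k=1..n. b j k (x, t) * w k (x, t))
        + (\<Sum>k=1..n. integral {0..x} (\<lambda>y. g j k (y, t) * w k (y, t))))"
    unfolding cl using t j
    by (intro continuous_intros continuous_on_Omega_bar_slice indefinite_integral_continuous_1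
        integrable_continuous_real wt_cont wx_cont w_cont a_cont b_cont g_cont) auto
  from continuous_constant_on_closure[OF this] show ?thesis
    using pde_interior[OF j] x t by (auto simp: Omega_def cl)
qed

text \<open>
  This is the integral of the k-th component from its inlet to x.  Starting at the inlet makes the
  boundary term in its time derivative a value that the boundary condition controls.
\<close>

definition primitive :: "nat \<Rightarrow> real \<times> real \<Rightarrow> real" where
  "primitive k p = integral {0..fst p} (\<lambda>y. w k (y, snd p)) - inlet k * integral {0..1} (\<lambda>y. w k (y, snd p))"

text \<open>
  The k-th equation in conservation form reads: the time derivative of \<open>w k\<close> plus the space
  derivative of \<open>a k * w k\<close> equals this function.  By the equation it involves no derivatives
  of w, which is what bounds its integral by the mass.
\<close>

definition production :: "nat \<Rightarrow> real \<times> real \<Rightarrow> real" where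
  "production k p = wt k p + ax k p * w k p + a k p * wx k p"

definition net_production :: "nat \<Rightarrow> real \<times> real \<Rightarrow> real" where
  "net_production k p = integral {0..fst p} (\<lambda>y. production k (y, snd p)) - inlet k * integral {0..1} (\<lambda>y. production k (y, snd p))"

lemma production_cont: "k \<in> {1..n} \<Longrightarrow> continuous_on Omega_bar (production k)"
  unfolding production_def by (intro continuous_intros wt_cont wx_cont w_cont a_cont ax_cont)

lemma integral_wt:
  assumes k: "k \<in> {1..n}" and x: "x \<in> {0..1}" and t: "0 \<le> t"
  shows "integral {0..x} (\<lambda>y. wt k (y, t)) =
    integral {0..x} (\<lambda>y. production k (y, t)) - (a k (x, t) * w k (x, t) - a k (0, t) * w k (0, t))"
proof -
  have "((\<lambda>y. ax k (y, t) * w k (y, t) + a k (y, t) * wx k (y, t)) has_integral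
      (a k (x, t) * w k (x, t) - a k (0, t) * w k (0, t))) {0..x}"
  proof (rule fundamental_theorem_of_calculus)
    fix y assume y: "y \<in> {0..x}"
    have "((\<lambda>y. a k (y, t) * w k (y, t)) has_real_derivative ax k (y, t) * w k (y, t) + a k (y, t) * wx k (y, t))
        (at y within {0..1})"
      using has_derivative_Omega_bar_slices(1)[OF w_deriv[OF k], of y t] a_deriv[OF k, of y t] x y t
      by (auto intro!: derivative_eq_intros simp: Omega_bar_iff)
    then show "((\<lambda>y. a k (y, t) * w k (y, t)) has_vector_derivative ax k (y, t) * w k (y, t) + a k (y, t) * wx k (y, t))
        (at y within {0..x})"
      using x by (auto simp: has_real_derivative_iff_has_vector_derivative intro: has_vector_derivative_within_subset)
  qed (use x in auto)
  moreover have "((\<lambda>y. wt k (y, t)) has_integral integral {0..x} (\<lambda>y. wt k (y, t))) {0..x}"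
    using x t by (intro integrable_integral integrable_continuous_real
      continuous_on_subset[OF continuous_on_Omega_bar_slice[OF wt_cont[OF k]]]) auto
  ultimately have "((\<lambda>y. production k (y, t)) has_integral integral {0..x} (\<lambda>y. wt k (y, t)) +
      (a k (x, t) * w k (x, t) - a k (0, t) * w k (0, t))) {0..x}"
    by (auto simp: production_def add.assoc intro: has_integral_add)
  then show ?thesis by (simp add: integral_unique)
qed

text \<open>
  By the conservation form, differentiating the primitive in time gives the flux through the inlet
  minus the flux at x, up to the integrated production.
\<close>

lemma primitive_deriv:
  assumes k: "k \<in> {1..n}" and p: "p \<in> Omega_bar"
  shows "(primitive k has_derivative (\<lambda>(h, s). w k p * h +
     (net_production k p + a k (inlet k, snd p) * w k (inlet k, snd p) - a k p * w k p) * s)) (at p within Omega_bar)"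
proof -
  obtain x t where pxt: "p = (x, t)" by (cases p)
  have xt: "x \<in> {0..1}" "0 \<le> t" using p by (auto simp: pxt Omega_bar_iff)
  note D = has_derivative_space_primitive[OF w_deriv[OF k] wt_cont[OF k]]
  have proj: "((\<lambda>q. (1::real, snd q)) has_derivative (\<lambda>q. (0, snd q))) (at (x, t) within Omega_bar)"
    by (auto intro!: derivative_eq_intros)
  have img: "(\<lambda>q. (1::real, snd q)) ` Omega_bar \<subseteq> Omega_bar" by (auto simp: Omega_bar_def)
  have total: "((\<lambda>q. integral {0..1} (\<lambda>y. w k (y, snd q))) has_derivative
      (\<lambda>(h, s). integral {0..1} (\<lambda>y. wt k (y, t)) * s)) (at (x, t) within Omega_bar)"
    using has_derivative_in_compose[OF proj has_derivative_subset[OF D img]] xt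
    by (simp add: Omega_bar_iff case_prod_unfold)
  have "(primitive k has_derivative (\<lambda>q. (\<lambda>(h, s). w k (x, t) * h + integral {0..x} (\<lambda>y. wt k (y, t)) * s) q
      - inlet k * (\<lambda>(h, s). integral {0..1} (\<lambda>y. wt k (y, t)) * s) q)) (at (x, t) within Omega_bar)"
    unfolding primitive_def[abs_def]
    using p by (intro derivative_intros D total) (auto simp: pxt)
  then show ?thesis
    unfolding pxt
  proof (rule has_derivative_eq_rhs)
    have "integral {0..x} (\<lambda>y. wt k (y, t)) - inlet k * integral {0..1} (\<lambda>y. wt k (y, t)) =
        net_production k (x, t) + a k (inlet k, t) * w k (inlet k, t) - a k (x, t) * w k (x, t)"
      using integral_wt[OF k xt] integral_wt[OF k _ xt(2), of 1] inlet_cases[of k]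
      by (auto simp: net_production_def)
    then show "(\<lambda>q. (\<lambda>(h, s). w k (x, t) * h + integral {0..x} (\<lambda>y. wt k (y, t)) * s) q
      - inlet k * (\<lambda>(h, s). integral {0..1} (\<lambda>y. wt k (y, t)) * s) q) = (\<lambda>(h, s). w k (x, t) * h +
     (net_production k (x, t) + a k (inlet k, snd (x, t)) * w k (inlet k, snd (x, t)) - a k (x, t) * w k (x, t)) * s)"
      by (auto simp: fun_eq_iff simp flip: left_diff_distrib mult.assoc)
  qed
qed

lemma primitive_bound:
  assumes k: "k \<in> {1..n}" and x: "x \<in> {0..1}" and t: "t \<in> {0..T}"
  shows "\<bar>primitive k (x, t)\<bar> \<le> 2 * N"
proof -
  have 1: "\<bar>integral {0..y} (\<lambda>z. w k (z, t))\<bar> \<le> N" if y: "y \<in> {0..1}" for y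
  proof -
    have "(\<Sum>l=1..n. integral {0..y} (\<lambda>z. of_bool (l = k) * w l (z, t)))
        = (\<Sum>l=1..n. if l = k then integral {0..y} (\<lambda>z. w k (z, t)) else 0)"
      by (intro sum.cong) auto
    also have "\<dots> = integral {0..y} (\<lambda>z. w k (z, t))" using k by simp
    finally show ?thesis
      using weighted_mass_bound[of "\<lambda>l y. of_bool (l = k)" 1, OF _ _ y t] by simp
  qed
  show ?thesis using 1[OF x] 1[of 1] inlet_cases[of k] by (auto simp: primitive_def)
qed


text \<open>
  Pointwise, the production is at most 2 M times the sum of the absolute values of the components, plus
  M N from the integral terms; integrating gives 2 M N + M N.
\<close>

lemma production_integral_bound:
  assumes k: "k \<in> {1..n}" and x: "x \<in> {0..1}" and t: "t \<in> {0<..T}"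
  shows "\<bar>integral {0..x} (\<lambda>y. production k (y, t))\<bar> \<le> 3 * M * N"
proof -
  have M0: "0 \<le> M" using M_nonneg[OF k] .
  define B where "B y = 2 * M * (\<Sum>l=1..n. \<bar>w l (y, t)\<bar>) + M * N" for y
  have sub: "{0..x} \<subseteq> {0..1}" using x by auto
  have Bc: "continuous_on {0..1} B"
    unfolding B_def using t by (intro continuous_intros continuous_on_Omega_bar_slice[OF w_cont]) auto
  have Sc: "continuous_on {0..1} (\<lambda>y. production k (y, t))"
    using t by (intro continuous_on_Omega_bar_slice[OF production_cont] k) auto
  have B0: "0 \<le> B y" for y
    unfolding B_def using M0 N_nonneg by (auto intro!: add_nonneg_nonneg mult_nonneg_nonneg sum_nonneg)
  have SB: "\<bar>production k (y, t)\<bar> \<le> B y" if y: "y \<in> {0..1}" for y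
  proof -
    have yt: "(y, t) \<in> {0..1} \<times> {0..T}" using y t by auto
    define G where "G = (\<Sum>l=1..n. integral {0..y} (\<lambda>z. g k l (z, t) * w l (z, t)))"
    define F where "F = (\<Sum>l=1..n. b k l (y, t) * w l (y, t))"
    have eq: "production k (y, t) = ax k (y, t) * w k (y, t) - F - G"
      using pde_closed[OF k y, of t] t by (simp add: production_def F_def G_def)
    have "\<bar>ax k (y, t) * w k (y, t)\<bar> \<le> M * \<bar>w k (y, t)\<bar>"
      unfolding abs_mult using bound1[OF k yt] by (intro mult_right_mono) auto
    also have "\<dots> \<le> M * (\<Sum>l=1..n. \<bar>w l (y, t)\<bar>)"
      using M0 k member_le_sum[of k "{1..n}" "\<lambda>l. \<bar>w l (y, t)\<bar>"] by (intro mult_left_mono) auto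
    finally have 1: "\<bar>ax k (y, t) * w k (y, t)\<bar> \<le> M * (\<Sum>l=1..n. \<bar>w l (y, t)\<bar>)" .
    have "\<bar>F\<bar> \<le> (\<Sum>l=1..n. M * \<bar>w l (y, t)\<bar>)"
      unfolding F_def
    proof (intro order_trans[OF sum_abs] sum_mono)
      fix l assume "l \<in> {1..n}"
      then show "\<bar>b k l (y, t) * w l (y, t)\<bar> \<le> M * \<bar>w l (y, t)\<bar>"
        unfolding abs_mult using bound2[OF k _ yt] by (intro mult_right_mono) auto
    qed
    then have 2: "\<bar>F\<bar> \<le> M * (\<Sum>l=1..n. \<bar>w l (y, t)\<bar>)" by (simp add: sum_distrib_left)
    have 3: "\<bar>G\<bar> \<le> M * N" unfolding G_def using memory_bound[OF k y, of t] t by simp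
    show ?thesis using eq 1 2 3 unfolding B_def by linarith
  qed
  have "\<bar>integral {0..x} (\<lambda>y. production k (y, t))\<bar> \<le> integral {0..x} B"
    unfolding real_norm_def[symmetric]
    by (rule integral_norm_bound_integral) (use SB sub in \<open>auto intro!: integrable_continuous_real
          continuous_on_subset[OF Sc sub] continuous_on_subset[OF Bc sub]\<close>)
  also have "\<dots> \<le> integral {0..1} B"
    by (rule integral_subset_le) (use sub B0 in \<open>auto intro!: integrable_continuous_real
          continuous_on_subset[OF Bc sub] Bc\<close>)
  also have "\<dots> = 2 * M * (\<Sum>l=1..n. integral {0..1} (\<lambda>y. \<bar>w l (y, t)\<bar>)) + M * N"
  proof -
    have int: "(\<lambda>y. \<bar>w l (y, t)\<bar>) integrable_on {0..1}" if "l \<in> {1..n}" for l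
      using t that by (intro integrable_continuous_real continuous_intros continuous_on_Omega_bar_slice[OF w_cont]) auto
    have "integral {0..1} B = integral {0..1} (\<lambda>y. 2 * M * (\<Sum>l=1..n. \<bar>w l (y, t)\<bar>)) + integral {0..1} (\<lambda>y::real. M * N)"
      unfolding B_def
      by (rule Henstock_Kurzweil_Integration.integral_add; rule integrable_continuous_real)
        (use t in \<open>auto intro!: continuous_intros continuous_on_Omega_bar_slice[OF w_cont]\<close>)
    also have "integral {0..1} (\<lambda>y. 2 * M * (\<Sum>l=1..n. \<bar>w l (y, t)\<bar>)) = 2 * M * (\<Sum>l=1..n. integral {0..1} (\<lambda>y. \<bar>w l (y, t)\<bar>))"
      using int by (subst Henstock_Kurzweil_Integration.integral_mult_right, subst Henstock_Kurzweil_Integration.integral_sum) auto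
    finally show ?thesis by simp
  qed
  also have "\<dots> \<le> 2 * M * N + M * N"
    using mass[of t] t M0 by (intro add_mono mult_left_mono) auto
  finally show ?thesis by simp
qed

lemma net_production_bound:
  assumes k: "k \<in> {1..n}" and x: "x \<in> {0..1}" and t: "t \<in> {0<..T}"
  shows "\<bar>net_production k (x, t)\<bar> \<le> 6 * M * N"
  using production_integral_bound[OF k x t] production_integral_bound[OF k _ t, of 1] inlet_cases[of k]
  by (auto simp: net_production_def)

text \<open>
  Along the characteristics of the j-th equation, the primitive of the k-th component changes at the
  rate \<open>(a j - a k) * w k\<close> up to terms bounded by the mass.  As
  \<open>b j k = \<beta> j k * (a k - a j)\<close>, subtracting these multiples of the primitives removes
  from the j-th equation every value at x of another component.
\<close>

definition compensated :: "nat \<Rightarrow> real \<times> real \<Rightarrow> real" where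
  "compensated j p = w j p - (\<Sum>k\<in>{1..n}-{j}. \<beta> j k p * primitive k p)"

text \<open>
  What remains of the time derivative of the primitive when the flux at x is left out; it is bounded
  by the mass.
\<close>

definition flux :: "nat \<Rightarrow> real \<times> real \<Rightarrow> real" where
  "flux k p = net_production k p + a k (inlet k, snd p) * w k (inlet k, snd p)"

definition compensated_x :: "nat \<Rightarrow> real \<times> real \<Rightarrow> real" where
  "compensated_x j p = wx j p - (\<Sum>k\<in>{1..n}-{j}. \<beta>x j k p * primitive k p + \<beta> j k p * w k p)"

definition compensated_t :: "nat \<Rightarrow> real \<times> real \<Rightarrow> real" where
  "compensated_t j p = wt j p - (\<Sum>k\<in>{1..n}-{j}. \<beta>t j k p * primitive k p + \<beta> j k p * (flux k p - a k p * w k p))"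

definition residual :: "nat \<Rightarrow> real \<times> real \<Rightarrow> real" where
  "residual j p = - (\<Sum>k=1..n. integral {0..fst p} (\<lambda>y. g j k (y, snd p) * w k (y, snd p)))
     - (\<Sum>k\<in>{1..n}-{j}. (\<beta>x j k p * a j p + \<beta>t j k p + b j j p * \<beta> j k p) * primitive k p + \<beta> j k p * flux k p)"

lemma compensated_deriv:
  assumes j: "j \<in> {1..n}" and p: "p \<in> Omega_bar"
  shows "(compensated j has_derivative (\<lambda>(h, s). compensated_x j p * h + compensated_t j p * s)) (at p within Omega_bar)"
proof -
  have "(compensated j has_derivative (\<lambda>q. (\<lambda>(h, s). wx j p * h + wt j p * s) q
      - (\<Sum>k\<in>{1..n}-{j}. \<beta> j k p * (\<lambda>(h, s). w k p * h + (flux k p - a k p * w k p) * s) q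
          + (\<lambda>(h, s). \<beta>x j k p * h + \<beta>t j k p * s) q * primitive k p))) (at p within Omega_bar)"
    unfolding compensated_def[abs_def] flux_def using j p
    by (intro derivative_intros w_deriv primitive_deriv \<beta>_deriv) auto
  then show ?thesis
  proof (rule has_derivative_eq_rhs)
    show "(\<lambda>q. (\<lambda>(h, s). wx j p * h + wt j p * s) q
      - (\<Sum>k\<in>{1..n}-{j}. \<beta> j k p * (\<lambda>(h, s). w k p * h + (flux k p - a k p * w k p) * s) q
          + (\<lambda>(h, s). \<beta>x j k p * h + \<beta>t j k p * s) q * primitive k p)) = (\<lambda>(h, s). compensated_x j p * h + compensated_t j p * s)"
      by (auto simp: fun_eq_iff compensated_x_def compensated_t_def sum_distrib_left sum_distrib_right sum.distrib sum_subtractf algebra_simps)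
  qed
qed

text \<open>
  Here the coupling assumption is used: the terms \<open>b j k * w k\<close> with k different from j cancel
  against the derivatives of the primitives.
\<close>

lemma compensated_transport:
  assumes j: "j \<in> {1..n}" and x: "x \<in> {0..1}" and t: "0 < t"
  shows "compensated_t j (x, t) + a j (x, t) * compensated_x j (x, t) = residual j (x, t) - b j j (x, t) * compensated j (x, t)"
proof -
  define p where "p = (x, t)"
  have p: "p \<in> Omega_bar" using x t by (auto simp: p_def Omega_bar_iff)
  define G where "G = (\<Sum>k=1..n. integral {0..x} (\<lambda>y. g j k (y, t) * w k (y, t)))"
  have "wt j p + a j p * wx j p + (\<Sum>k=1..n. b j k p * w k p) + G = 0"
    unfolding p_def G_def by (rule pde_closed[OF j x t])
  moreover have "(\<Sum>k=1..n. b j k p * w k p) = b j j p * w j p + (\<Sum>k\<in>{1..n}-{j}. b j k p * w k p)"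
    using j by (intro sum.remove) auto
  moreover have "(\<Sum>k\<in>{1..n}-{j}. b j k p * w k p) = (\<Sum>k\<in>{1..n}-{j}. \<beta> j k p * (a k p - a j p) * w k p)"
    using coupling[OF j _ _ p] by (intro sum.cong) auto
  ultimately have wteq: "wt j p = - a j p * wx j p - b j j p * w j p - G
      - (\<Sum>k\<in>{1..n}-{j}. \<beta> j k p * (a k p - a j p) * w k p)"
    by simp
  show ?thesis
    unfolding p_def[symmetric] residual_def compensated_t_def compensated_x_def compensated_def wteq
    by (simp add: p_def G_def sum_distrib_left algebra_simps flip: sum.distrib sum_subtractf)
qed

lemma residual_bound:
  assumes j: "j \<in> {1..n}" and x: "x \<in> {0..1}" and t: "t \<in> {0<..T}"
  shows "\<bar>residual j (x, t)\<bar> \<le> residual_const * N"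
proof -
  define p where "p = (x, t)"
  have p: "p \<in> {0..1} \<times> {0..T}" using x t by (auto simp: p_def)
  have M0: "0 \<le> M" using M_nonneg[OF j] .
  have N0: "0 \<le> N" by (rule N_nonneg)
  have summand: "\<bar>(\<beta>x j k p * a j p + \<beta>t j k p + b j j p * \<beta> j k p) * primitive k p + \<beta> j k p * flux k p\<bar>
      \<le> (M ^ 3 + 10 * M\<^sup>2 + 2 * M) * N" if "k \<in> {1..n}-{j}" for k
  proof -
    have k: "k \<in> {1..n}" "j \<noteq> k" using that by auto
    have bd: "\<bar>\<beta> j k p\<bar> \<le> M" "\<bar>\<beta>x j k p\<bar> \<le> M" "\<bar>\<beta>t j k p\<bar> \<le> M" "\<bar>a j p\<bar> \<le> M" "\<bar>b j j p\<bar> \<le> M"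
      using bound3[OF j k p] bound1[OF j p] bound2[OF j j p] by auto
    have "\<bar>\<beta>x j k p * a j p\<bar> \<le> M * M" "\<bar>b j j p * \<beta> j k p\<bar> \<le> M * M"
      unfolding abs_mult using bd M0 by (simp_all add: mult_mono)
    then have c: "\<bar>\<beta>x j k p * a j p + \<beta>t j k p + b j j p * \<beta> j k p\<bar> \<le> M * M + M + M * M"
      using bd by linarith
    have "\<bar>(\<beta>x j k p * a j p + \<beta>t j k p + b j j p * \<beta> j k p) * primitive k p\<bar> \<le> (M * M + M + M * M) * (2 * N)"
      unfolding abs_mult using c primitive_bound[OF k(1) x, of t] t M0 by (intro mult_mono) (auto simp: p_def)
    moreover have "\<bar>a k (inlet k, t) * w k (inlet k, t)\<bar> \<le> M * (M * N)"
      unfolding abs_mult using bound1[OF k(1), of "(inlet k, t)"] inlet_bound[OF k(1), of t] inlet_cases[of k] t M0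
      by (intro mult_mono) auto
    then have "\<bar>flux k p\<bar> \<le> 6 * M * N + M * (M * N)"
      using net_production_bound[OF k(1) x t] by (simp add: flux_def p_def)
    then have "\<bar>\<beta> j k p * flux k p\<bar> \<le> M * (6 * M * N + M * (M * N))"
      unfolding abs_mult using bd M0 by (intro mult_mono) auto
    ultimately have "\<bar>(\<beta>x j k p * a j p + \<beta>t j k p + b j j p * \<beta> j k p) * primitive k p + \<beta> j k p * flux k p\<bar>
       \<le> (M * M + M + M * M) * (2 * N) + M * (6 * M * N + M * (M * N))" by linarith
    also have "\<dots> = (M ^ 3 + 10 * M\<^sup>2 + 2 * M) * N" by (simp add: algebra_simps power2_eq_square power3_eq_cube)
    finally show ?thesis .
  qed
  have "\<bar>\<Sum>k\<in>{1..n}-{j}. (\<beta>x j k p * a j p + \<beta>t j k p + b j j p * \<beta> j k p) * primitive k p + \<beta> j k p * flux k p\<bar>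
      \<le> (\<Sum>k\<in>{1..n}-{j}. (M ^ 3 + 10 * M\<^sup>2 + 2 * M) * N)"
    by (intro order_trans[OF sum_abs] sum_mono summand)
  also have "\<dots> \<le> real n * ((M ^ 3 + 10 * M\<^sup>2 + 2 * M) * N)"
  proof -
    have "card ({1..n}-{j}) \<le> card {1..n}" by (intro card_mono) auto
    then show ?thesis using M0 N0 by (simp only: sum_constant) (intro mult_right_mono, auto)
  qed
  finally have "\<bar>residual j p\<bar> \<le> M * N + real n * ((M ^ 3 + 10 * M\<^sup>2 + 2 * M) * N)"
    using memory_bound[OF j x, of t] t unfolding residual_def by (simp add: p_def)
  then show ?thesis by (simp add: p_def residual_const_def distrib_right mult.assoc)
qed

lemma compensator_bound:
  assumes j: "j \<in> {1..n}" and x: "x \<in> {0..1}" and t: "t \<in> {0..T}"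
  shows "\<bar>\<Sum>k\<in>{1..n}-{j}. \<beta> j k (x, t) * primitive k (x, t)\<bar> \<le> real n * (2 * M) * N"
proof -
  have M0: "0 \<le> M" using M_nonneg[OF j] .
  have N0: "0 \<le> N" by (rule N_nonneg)
  have "\<bar>\<beta> j k (x, t) * primitive k (x, t)\<bar> \<le> M * (2 * N)" if "k \<in> {1..n}-{j}" for k
    unfolding abs_mult using bound3[OF j, of k "(x, t)"] primitive_bound[of k x t] x t M0 that by (intro mult_mono) auto
  then have "\<bar>\<Sum>k\<in>{1..n}-{j}. \<beta> j k (x, t) * primitive k (x, t)\<bar> \<le> (\<Sum>k\<in>{1..n}-{j}. M * (2 * N))"
    by (intro order_trans[OF sum_abs] sum_mono)
  also have "\<dots> \<le> real n * (M * (2 * N))"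
  proof -
    have "card ({1..n}-{j}) \<le> card {1..n}" by (intro card_mono) auto
    then show ?thesis using M0 N0 by (simp only: sum_constant) (intro mult_right_mono, auto)
  qed
  finally show ?thesis by (simp add: algebra_simps)
qed

lemma residual_const_ge:
  assumes "0 \<le> M"
  shows "M + real n * (2 * M) \<le> residual_const"
proof -
  have "real n * (2 * M) \<le> real n * (M ^ 3 + 10 * M\<^sup>2 + 2 * M)"
    using assms by (intro mult_left_mono) auto
  then show ?thesis by (simp add: residual_const_def)
qed

lemma compensated_inlet_bound:
  assumes j: "j \<in> {1..n}" and t: "t \<in> {0..T}"
  shows "\<bar>compensated j (inlet j, t)\<bar> \<le> residual_const * N"
proof -
  have "inlet j \<in> {0..1}" using inlet_cases[of j] by auto
  then have "\<bar>compensated j (inlet j, t)\<bar> \<le> (M + real n * (2 * M)) * N"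
    using inlet_bound[OF j t] compensator_bound[OF j _ t, of "inlet j"]
    unfolding compensated_def distrib_right by linarith
  also have "\<dots> \<le> residual_const * N"
    by (intro mult_right_mono residual_const_ge N_nonneg M_nonneg[OF j])
  finally show ?thesis .
qed

text \<open>
  If \<open>\<alpha> * t \<ge> 1\<close>, the point (x, t) lies in the region of the maximum principle for
  either inlet, since a characteristic needs at most the time \<open>1 / \<alpha>\<close> to cross the
  interval.  So the bound of the compensated component at its inlet is carried to (x, t).
\<close>

lemma smoothing_estimate:
  assumes j: "j \<in> {1..n}" and x: "x \<in> {0..1}" and t: "t \<in> {0..T}" and late: "1 \<le> \<alpha> * t"
  shows "\<bar>w j (x, t)\<bar> \<le> (residual_const * exp ((M + 1) * T) + real n * (2 * M)) * N"
proof -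
  have M0: "0 \<le> M" using M_nonneg[OF j] .
  have C0: "0 \<le> residual_const * N"
  proof -
    have "0 \<le> M + real n * (2 * M)" using M0 by simp
    then have "0 \<le> residual_const" using residual_const_ge[OF M0] by linarith
    then show ?thesis using N_nonneg by simp
  qed
  have speed: "\<alpha> \<le> (1 - 2 * inlet j) * a j p" if "p \<in> Omega_bar" for p
    using speed_left[of j p] speed_right[of j p] j that by (auto simp: inlet_def)
  have in_K: "\<bar>x - inlet j\<bar> \<le> \<alpha> * t" using x late inlet_cases[of j] by auto
  have "compensated j (x, t) \<le> residual_const * N * exp ((M + 1) * T)"
  proof (rule transport_maximum_principle[where Zx="compensated_x j" and Zt="compensated_t j" and av="a j" and c="b j j" and R="residual j"])
    show "inlet j \<in> {0, 1}" by (rule inlet_cases)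
    show "compensated j (inlet j, s) \<le> residual_const * N" if "0 \<le> s" "s \<le> T" for s
      using compensated_inlet_bound[OF j, of s] that by auto
    show "compensated_t j p + a j p * compensated_x j p = residual j p - b j j p * compensated j p"
      if "p \<in> {(x, t). 0 \<le> x \<and> x \<le> 1 \<and> 0 \<le> t \<and> t \<le> T \<and> \<bar>x - inlet j\<bar> \<le> \<alpha> * t}" "0 < snd p" for p
      using compensated_transport[OF j, of "fst p" "snd p"] that by (auto simp: case_prod_unfold)
  qed (use j x t in_K \<alpha> M0 C0 in \<open>auto simp: Omega_bar_iff intro!: compensated_deriv speed residual_bound
        bound2[THEN conjunct1]\<close>)
  moreover have "- compensated j (x, t) \<le> residual_const * N * exp ((M + 1) * T)"
  proof (rule transport_maximum_principle[where Z="\<lambda>p. - compensated j p" and Zx="\<lambda>p. - compensated_x j p" and Zt="\<lambda>p. - compensated_t j p"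
        and av="a j" and c="b j j" and R="\<lambda>p. - residual j p"])
    show "inlet j \<in> {0, 1}" by (rule inlet_cases)
    show "- compensated j (inlet j, s) \<le> residual_const * N" if "0 \<le> s" "s \<le> T" for s
      using compensated_inlet_bound[OF j, of s] that by auto
    show "((\<lambda>p. - compensated j p) has_derivative (\<lambda>(h, k). - compensated_x j p * h + - compensated_t j p * k)) (at p within Omega_bar)"
      if "p \<in> Omega_bar" for p
      using has_derivative_minus[OF compensated_deriv[OF j that]]
      by (rule has_derivative_eq_rhs) (auto simp: fun_eq_iff)
    show "- compensated_t j p + a j p * - compensated_x j p = - residual j p - b j j p * - compensated j p"
      if "p \<in> {(x, t). 0 \<le> x \<and> x \<le> 1 \<and> 0 \<le> t \<and> t \<le> T \<and> \<bar>x - inlet j\<bar> \<le> \<alpha> * t}" "0 < snd p" for p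
      using compensated_transport[OF j, of "fst p" "snd p"] that by (auto simp: case_prod_unfold)
  qed (use j x t in_K \<alpha> M0 C0 in \<open>auto simp: Omega_bar_iff intro!: speed residual_bound
        bound2[THEN conjunct1]\<close>)
  ultimately have "\<bar>compensated j (x, t)\<bar> \<le> residual_const * N * exp ((M + 1) * T)" by linarith
  then have "\<bar>w j (x, t)\<bar> \<le> residual_const * N * exp ((M + 1) * T) + real n * (2 * M) * N"
    using compensator_bound[OF j x t] unfolding compensated_def by linarith
  then show ?thesis by (simp add: algebra_simps)
qed

end

section \<open>Square integrable functions on the unit interval\<close>

lemma lebesgue_on_unit_interval_continuous:
  fixes v :: "real \<Rightarrow> real"
  assumes "continuous_on {0..1} v"
  shows "integrable (lebesgue_on {0<..<1}) v"
    and "(\<integral>x. v x \<partial>lebesgue_on {0<..<1}) = integral {0..1} v"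
proof -
  have "v absolutely_integrable_on {0<..<1}"
    by (rule set_integrable_subset[OF absolutely_integrable_continuous_real[OF assms]]) auto
  then show *: "integrable (lebesgue_on {0<..<1}) v"
    by (rule absolutely_integrable_imp_integrable) auto
  show "(\<integral>x. v x \<partial>lebesgue_on {0<..<1}) = integral {0..1} v"
    by (subst lebesgue_integral_eq_integral[OF *]) (auto simp: integral_open_interval_real)
qed

lemma continuous_in_L2_space: "continuous_on {0..1} v \<Longrightarrow> v \<in> L2_space"
  unfolding L2_space_def
  using lebesgue_on_unit_interval_continuous(1)[of v] lebesgue_on_unit_interval_continuous(1)[of "\<lambda>x. (v x)\<^sup>2"]
  by (auto intro!: continuous_intros)

lemma L2_space_diff:
  assumes "v \<in> L2_space" "w \<in> L2_space"
  shows "(\<lambda>x. v x - w x) \<in> L2_space"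
proof -
  have "integrable (lebesgue_on {0<..<1}) (\<lambda>x. (v x - w x)\<^sup>2)"
  proof (rule Bochner_Integration.integrable_bound)
    show "integrable (lebesgue_on {0<..<1}) (\<lambda>x. 2 * (v x)\<^sup>2 + 2 * (w x)\<^sup>2)"
      using assms by (auto simp: L2_space_def)
    show "AE x in lebesgue_on {0<..<1}. norm ((v x - w x)\<^sup>2) \<le> norm (2 * (v x)\<^sup>2 + 2 * (w x)\<^sup>2)"
    proof (rule AE_I2)
      fix x
      have "(v x - w x)\<^sup>2 \<le> 2 * (v x)\<^sup>2 + 2 * (w x)\<^sup>2"
        using zero_le_power2[of "v x + w x"] by (simp add: power2_sum power2_diff)
      then show "norm ((v x - w x)\<^sup>2) \<le> norm (2 * (v x)\<^sup>2 + 2 * (w x)\<^sup>2)"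
        by simp
    qed
  qed (use assms in \<open>auto simp: L2_space_def\<close>)
  then show ?thesis using assms by (auto simp: L2_space_def)
qed

text \<open>
  A substitute for the triangle inequality that needs only the pointwise inequality
  \<open>(p - q)\<^sup>2 \<le> 2 * p\<^sup>2 + 2 * q\<^sup>2\<close>.
\<close>

lemma L2_parallelogram_bound:
  assumes "(\<lambda>x. v x - w x) \<in> L2_space" "(\<lambda>x. v x - z x) \<in> L2_space" "(\<lambda>x. w x - z x) \<in> L2_space"
  shows "(\<integral>x. (w x - z x)\<^sup>2 \<partial>lebesgue_on {0<..<1})
    \<le> 2 * (\<integral>x. (v x - w x)\<^sup>2 \<partial>lebesgue_on {0<..<1}) + 2 * (\<integral>x. (v x - z x)\<^sup>2 \<partial>lebesgue_on {0<..<1})"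
proof -
  have int: "integrable (lebesgue_on {0<..<1}) (\<lambda>x. (v x - w x)\<^sup>2)"
    "integrable (lebesgue_on {0<..<1}) (\<lambda>x. (v x - z x)\<^sup>2)"
    "integrable (lebesgue_on {0<..<1}) (\<lambda>x. (w x - z x)\<^sup>2)"
    using assms by (auto simp: L2_space_def)
  have "(\<integral>x. (w x - z x)\<^sup>2 \<partial>lebesgue_on {0<..<1})
      \<le> (\<integral>x. 2 * (v x - w x)\<^sup>2 + 2 * (v x - z x)\<^sup>2 \<partial>lebesgue_on {0<..<1})"
  proof (rule integral_mono)
    show "(w x - z x)\<^sup>2 \<le> 2 * (v x - w x)\<^sup>2 + 2 * (v x - z x)\<^sup>2" for x
      using zero_le_power2[of "(v x - w x) + (v x - z x)"] by (simp add: power2_eq_square algebra_simps)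
  qed (use int in auto)
  then show ?thesis using int by simp
qed

lemma component_le_L2_norm_vec:
  assumes "j \<in> {1..n}"
  shows "(\<integral>x. (v j x)\<^sup>2 \<partial>lebesgue_on {0<..<1}) \<le> (L2_norm_vec n v)\<^sup>2"
proof -
  have "(\<integral>x. (v j x)\<^sup>2 \<partial>lebesgue_on {0<..<1}) \<le> (\<Sum>j=1..n. \<integral>x. (v j x)\<^sup>2 \<partial>lebesgue_on {0<..<1})"
    using assms by (intro member_le_sum) auto
  then show ?thesis
    unfolding L2_norm_vec_def by (subst real_sqrt_pow2) (auto intro!: sum_nonneg)
qed

text \<open>
  The variance of the absolute value of v on the unit interval is nonnegative.
\<close>

lemma L1_le_L2:
  fixes v :: "real \<Rightarrow> real"
  assumes "continuous_on {0..1} v"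
  shows "integral {0..1} (\<lambda>x. \<bar>v x\<bar>) \<le> sqrt (\<integral>x. (v x)\<^sup>2 \<partial>lebesgue_on {0<..<1})"
proof -
  define c where "c = integral {0..1} (\<lambda>x. \<bar>v x\<bar>)"
  have int: "(\<lambda>x. (v x)\<^sup>2) integrable_on {0..1}" "(\<lambda>x. \<bar>v x\<bar>) integrable_on {0..1}"
    using assms by (auto intro!: integrable_continuous_real continuous_intros)
  have "0 \<le> integral {0..1} (\<lambda>x. (\<bar>v x\<bar> - c)\<^sup>2)"
    by (rule Henstock_Kurzweil_Integration.integral_nonneg)
      (auto intro!: integrable_continuous_real continuous_intros assms)
  also have "(\<lambda>x. (\<bar>v x\<bar> - c)\<^sup>2) = (\<lambda>x. (v x)\<^sup>2 - 2 * c * \<bar>v x\<bar> + c\<^sup>2)"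
    by (auto simp: power2_eq_square algebra_simps)
  also have "integral {0..1} \<dots> = integral {0..1} (\<lambda>x. (v x)\<^sup>2) - 2 * c * c + c\<^sup>2"
  proof (rule integral_unique)
    have "((\<lambda>x. (v x)\<^sup>2) has_integral integral {0..1} (\<lambda>x. (v x)\<^sup>2)) {0..1}"
      "((\<lambda>x. \<bar>v x\<bar>) has_integral c) {0..1}"
      using int by (auto simp: c_def)
    moreover have "((\<lambda>x. c\<^sup>2) has_integral c\<^sup>2) {0..1::real}"
      using has_integral_const_real[of "c\<^sup>2" 0 1] by simp
    ultimately show "((\<lambda>x. (v x)\<^sup>2 - 2 * c * \<bar>v x\<bar> + c\<^sup>2) has_integral
        integral {0..1} (\<lambda>x. (v x)\<^sup>2) - 2 * c * c + c\<^sup>2) {0..1}"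
      by (intro has_integral_add has_integral_diff has_integral_mult_right)
  qed
  finally have "c\<^sup>2 \<le> integral {0..1} (\<lambda>x. (v x)\<^sup>2)" by (simp add: power2_eq_square)
  then show ?thesis
    unfolding c_def[symmetric]
    by (subst lebesgue_on_unit_interval_continuous(2)) (auto intro!: real_le_rsqrt continuous_intros assms)
qed

lemma mass_le_L2_norm_vec:
  assumes "\<And>j. j \<in> {1..n} \<Longrightarrow> continuous_on {0..1} (v j)"
  shows "(\<Sum>j=1..n. integral {0..1} (\<lambda>x. \<bar>v j x\<bar>)) \<le> real n * L2_norm_vec n v"
proof -
  have nonneg: "0 \<le> L2_norm_vec n v"
    unfolding L2_norm_vec_def by (auto intro!: sum_nonneg)
  have "integral {0..1} (\<lambda>x. \<bar>v j x\<bar>) \<le> L2_norm_vec n v" if j: "j \<in> {1..n}" for j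
  proof -
    have "integral {0..1} (\<lambda>x. \<bar>v j x\<bar>) \<le> sqrt (\<integral>x. (v j x)\<^sup>2 \<partial>lebesgue_on {0<..<1})"
      by (rule L1_le_L2[OF assms[OF j]])
    also have "\<dots> \<le> sqrt ((L2_norm_vec n v)\<^sup>2)"
      by (intro real_sqrt_le_mono component_le_L2_norm_vec j)
    finally show ?thesis using nonneg by simp
  qed
  then have "(\<Sum>j=1..n. integral {0..1} (\<lambda>x. \<bar>v j x\<bar>)) \<le> (\<Sum>j=1..n. L2_norm_vec n v)"
    by (intro sum_mono) auto
  then show ?thesis by simp
qed

lemma L2_norm_vec_diff_le:
  assumes u: "\<And>j. j \<in> {1..n} \<Longrightarrow> u j \<in> L2_space"
    and v: "\<And>j. j \<in> {1..n} \<Longrightarrow> v j \<in> L2_space" and w: "\<And>j. j \<in> {1..n} \<Longrightarrow> w j \<in> L2_space"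
    and e: "L2_norm_vec n (\<lambda>j x. u j x - v j x) \<le> e" "L2_norm_vec n (\<lambda>j x. u j x - w j x) \<le> e"
  shows "L2_norm_vec n (\<lambda>j x. v j x - w j x) \<le> 2 * e"
proof -
  have sq: "(L2_norm_vec n z)\<^sup>2 = (\<Sum>j=1..n. \<integral>x. (z j x)\<^sup>2 \<partial>lebesgue_on {0<..<1})" for z
    unfolding L2_norm_vec_def by (rule real_sqrt_pow2) (auto intro!: sum_nonneg)
  have nonneg: "0 \<le> L2_norm_vec n z" for z
    unfolding L2_norm_vec_def by (auto intro!: sum_nonneg)
  have "(L2_norm_vec n (\<lambda>j x. v j x - w j x))\<^sup>2 \<le>
      2 * (L2_norm_vec n (\<lambda>j x. u j x - v j x))\<^sup>2 + 2 * (L2_norm_vec n (\<lambda>j x. u j x - w j x))\<^sup>2"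
    unfolding sq sum_distrib_left sum.distrib[symmetric]
    by (intro sum_mono L2_parallelogram_bound L2_space_diff u v w)
  also have "\<dots> \<le> 2 * e\<^sup>2 + 2 * e\<^sup>2"
    using e nonneg by (intro add_mono mult_left_mono power_mono) auto
  also have "\<dots> = (2 * e)\<^sup>2" by simp
  finally show ?thesis
    by (rule power2_le_imp_le) (use order_trans[OF nonneg e(1)] in simp)
qed

section \<open>Differences of classical solutions\<close>

lemma common_bound_on_slab:
  fixes F :: "(real \<times> real \<Rightarrow> real) set"
  assumes "finite F" "\<And>v. v \<in> F \<Longrightarrow> continuous_on Omega_bar v"
  shows "\<exists>M. \<forall>v\<in>F. \<forall>p\<in>{0..1} \<times> {0..T}. \<bar>v p\<bar> \<le> M"
proof -
  have "bounded (\<Union>v\<in>F. v ` ({0..1} \<times> {0..T}))"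
  proof (rule bounded_UN[OF assms(1)], rule ballI)
    fix v assume "v \<in> F"
    then have "continuous_on ({0..1} \<times> {0..T}) v"
      by (rule continuous_on_subset[OF assms(2)]) (auto simp: Omega_bar_def)
    then show "bounded (v ` ({0..1} \<times> {0..T}))"
      by (intro compact_imp_bounded compact_continuous_image compact_Times) auto
  qed
  then show ?thesis by (fastforce simp: bounded_iff)
qed

lemma C1_Omega_bar_deriv:
  assumes "v \<in> C1_Omega_bar"
  obtains vx vt where "continuous_on Omega_bar vx" "continuous_on Omega_bar vt"
    "\<And>p. p \<in> Omega_bar \<Longrightarrow> (v has_derivative (\<lambda>(h, k). vx p * h + vt p * k)) (at p within Omega_bar)"
  using assms unfolding C1_Omega_bar_def by blast

lemma C1_Omega_bar_continuous: "v \<in> C1_Omega_bar \<Longrightarrow> continuous_on Omega_bar v"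
  by (erule C1_Omega_bar_deriv) (meson differentiable_imp_continuous_on differentiable_on_def differentiableI)

lemma C1_Omega_bar_diff:
  assumes "v \<in> C1_Omega_bar" "w \<in> C1_Omega_bar"
  shows "(\<lambda>p. v p - w p) \<in> C1_Omega_bar"
proof -
  obtain vx vt where v: "continuous_on Omega_bar vx" "continuous_on Omega_bar vt"
    "\<And>p. p \<in> Omega_bar \<Longrightarrow> (v has_derivative (\<lambda>(h, k). vx p * h + vt p * k)) (at p within Omega_bar)"
    using C1_Omega_bar_deriv[OF assms(1)] by metis
  obtain wx wt where w: "continuous_on Omega_bar wx" "continuous_on Omega_bar wt"
    "\<And>p. p \<in> Omega_bar \<Longrightarrow> (w has_derivative (\<lambda>(h, k). wx p * h + wt p * k)) (at p within Omega_bar)"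
    using C1_Omega_bar_deriv[OF assms(2)] by metis
  have "((\<lambda>p. v p - w p) has_derivative (\<lambda>(h, k). (vx p - wx p) * h + (vt p - wt p) * k)) (at p within Omega_bar)"
    if "p \<in> Omega_bar" for p
    using has_derivative_diff[OF v(3)[OF that] w(3)[OF that]]
    by (rule has_derivative_eq_rhs) (auto simp: fun_eq_iff algebra_simps)
  moreover have "continuous_on Omega_bar (\<lambda>p. vx p - wx p)" "continuous_on Omega_bar (\<lambda>p. vt p - wt p)"
    by (intro continuous_intros v w)+
  ultimately show ?thesis unfolding C1_Omega_bar_def by blast
qed

lemma C1_Omega_bar_partials:
  assumes der: "\<And>p. p \<in> Omega_bar \<Longrightarrow> (v has_derivative (\<lambda>(h, k). vx p * h + vt p * k)) (at p within Omega_bar)"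
    and "(x, t) \<in> Omega"
  shows "((\<lambda>y. v (y, t)) has_real_derivative vx (x, t)) (at x)"
    and "((\<lambda>s. v (x, s)) has_real_derivative vt (x, t)) (at t)"
proof -
  have x: "0 < x" "x < 1" and t: "0 < t" using assms(2) by (auto simp: Omega_def)
  then have p: "(x, t) \<in> Omega_bar" by (simp add: Omega_bar_iff)
  have "at x within {0..1} = at x" "at t within {0..} = at t"
    using x t by (auto intro!: at_within_interior)
  then show "((\<lambda>y. v (y, t)) has_real_derivative vx (x, t)) (at x)"
    "((\<lambda>s. v (x, s)) has_real_derivative vt (x, t)) (at t)"
    using has_derivative_Omega_bar_slices[of v vx vt x t, OF der p] by simp_all
qed

text \<open>
  The forcing cancels, so the estimates for the problem without forcing apply to the differences of
  the approximating solutions.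
\<close>

lemma classical_solutions_difference:
  assumes u: "classical_solution n m a b g r f \<phi> u" and u': "classical_solution n m a b g r f \<psi> u'"
    and mn: "m \<le> n"
    and g: "\<And>j k. j \<in> {1..n} \<Longrightarrow> k \<in> {1..n} \<Longrightarrow> continuous_on Omega_bar (g j k)"
    and r: "\<And>j k. j \<in> {1..n} \<Longrightarrow> k \<in> {1..n} \<Longrightarrow> continuous_on Omega_bar (r j k)"
  shows "classical_solution n m a b g r (\<lambda>_ _. 0) (\<lambda>j x. \<phi> j x - \<psi> j x) (\<lambda>j p. u j p - u' j p)"
proof -
  have C1: "u j \<in> C1_Omega_bar" "u' j \<in> C1_Omega_bar" if "j \<in> {1..n}" for j
    using u u' that by (auto simp: classical_solution_def)
  note cont = C1[THEN C1_Omega_bar_continuous]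
  have int: "integral {0..x} (\<lambda>y. c (y, t) * (u k (y, t) - u' k (y, t))) =
      integral {0..x} (\<lambda>y. c (y, t) * u k (y, t)) - integral {0..x} (\<lambda>y. c (y, t) * u' k (y, t))"
    if "continuous_on Omega_bar c" "k \<in> {1..n}" "x \<in> {0..1}" "0 \<le> t" for c k x t
    unfolding right_diff_distrib
  proof (rule Henstock_Kurzweil_Integration.integral_diff)
    have sub: "{0..x} \<subseteq> {0..1}" using that by auto
    show "(\<lambda>y. c (y, t) * u k (y, t)) integrable_on {0..x}" "(\<lambda>y. c (y, t) * u' k (y, t)) integrable_on {0..x}"
      by (intro integrable_continuous_real continuous_intros
          continuous_on_subset[OF continuous_on_Omega_bar_slice sub] cont that)+
  qed
  have pde: "deriv (\<lambda>s. u j (x, s) - u' j (x, s)) t + a j (x, t) * deriv (\<lambda>y. u j (y, t) - u' j (y, t)) x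
        + (\<Sum>k=1..n. b j k (x, t) * (u k (x, t) - u' k (x, t)))
        + (\<Sum>k=1..n. integral {0..x} (\<lambda>y. g j k (y, t) * (u k (y, t) - u' k (y, t)))) = 0"
    if j: "j \<in> {1..n}" and xt: "(x, t) \<in> Omega" for j x t
  proof -
    have xt': "x \<in> {0..1}" "0 \<le> t" using xt by (auto simp: Omega_def)
    obtain vx vt where v: "\<And>p. p \<in> Omega_bar \<Longrightarrow> (u j has_derivative (\<lambda>(h, k). vx p * h + vt p * k)) (at p within Omega_bar)"
      using C1_Omega_bar_deriv[OF C1(1)[OF j]] by metis
    obtain wx wt where w: "\<And>p. p \<in> Omega_bar \<Longrightarrow> (u' j has_derivative (\<lambda>(h, k). wx p * h + wt p * k)) (at p within Omega_bar)"
      using C1_Omega_bar_deriv[OF C1(2)[OF j]] by metis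
    note V = C1_Omega_bar_partials[OF v xt] and W = C1_Omega_bar_partials[OF w xt]
    have eqs: "deriv (\<lambda>s. u j (x, s)) t + a j (x, t) * deriv (\<lambda>y. u j (y, t)) x
        + (\<Sum>k=1..n. b j k (x, t) * u k (x, t)) + (\<Sum>k=1..n. integral {0..x} (\<lambda>y. g j k (y, t) * u k (y, t))) = f j (x, t)"
      "deriv (\<lambda>s. u' j (x, s)) t + a j (x, t) * deriv (\<lambda>y. u' j (y, t)) x
        + (\<Sum>k=1..n. b j k (x, t) * u' k (x, t)) + (\<Sum>k=1..n. integral {0..x} (\<lambda>y. g j k (y, t) * u' k (y, t))) = f j (x, t)"
      using u u' j xt by (auto simp: classical_solution_def)
    have "(\<Sum>k=1..n. integral {0..x} (\<lambda>y. g j k (y, t) * (u k (y, t) - u' k (y, t)))) =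
       (\<Sum>k=1..n. integral {0..x} (\<lambda>y. g j k (y, t) * u k (y, t)) - integral {0..x} (\<lambda>y. g j k (y, t) * u' k (y, t)))"
      by (intro sum.cong int g j xt') auto
    moreover have "deriv (\<lambda>s. u j (x, s) - u' j (x, s)) t = deriv (\<lambda>s. u j (x, s)) t - deriv (\<lambda>s. u' j (x, s)) t"
      "deriv (\<lambda>y. u j (y, t) - u' j (y, t)) x = deriv (\<lambda>y. u j (y, t)) x - deriv (\<lambda>y. u' j (y, t)) x"
      using DERIV_imp_deriv[OF DERIV_diff[OF V(1) W(1)]] DERIV_imp_deriv[OF DERIV_diff[OF V(2) W(2)]]
        V[THEN DERIV_imp_deriv] W[THEN DERIV_imp_deriv] by simp_all
    ultimately show ?thesis using eqs by (simp add: right_diff_distrib sum_subtractf)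
  qed
  have bc: "(\<Sum>k=1..n. integral {0..1} (\<lambda>x. r j k (x, t) * (u k (x, t) - u' k (x, t)))) =
      (\<Sum>k=1..n. integral {0..1} (\<lambda>x. r j k (x, t) * u k (x, t))) - (\<Sum>k=1..n. integral {0..1} (\<lambda>x. r j k (x, t) * u' k (x, t)))"
    if "j \<in> {1..n}" "0 \<le> t" for j t
    unfolding sum_subtractf[symmetric] by (intro sum.cong int r that) auto
  show ?thesis
    unfolding classical_solution_def
  proof (intro conjI ballI allI impI)
    show "(\<lambda>p. u j p - u' j p) \<in> C1_Omega_bar" if "j \<in> {1..n}" for j
      using C1[OF that] by (rule C1_Omega_bar_diff)
    show "u j (0, t) - u' j (0, t) = (\<Sum>k=1..n. integral {0..1} (\<lambda>x. r j k (x, t) * (u k (x, t) - u' k (x, t))))"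
      if "j \<in> {1..m}" "0 \<le> t" for j t
      using u u' that mn bc[of j t] by (auto simp: classical_solution_def)
    show "u j (1, t) - u' j (1, t) = (\<Sum>k=1..n. integral {0..1} (\<lambda>x. r j k (x, t) * (u k (x, t) - u' k (x, t))))"
      if "j \<in> {m<..n}" "0 \<le> t" for j t
      using u u' that bc[of j t] by (auto simp: classical_solution_def)
    show "u j (x, 0) - u' j (x, 0) = \<phi> j x - \<psi> j x" if "j \<in> {1..n}" "x \<in> {0..1}" for j x
      using u u' that by (auto simp: classical_solution_def)
  qed (use pde in auto)
qed

lemma (in transport_system) classical_solution_smoothing:
  assumes sol: "classical_solution n m a b g r (\<lambda>_ _. 0) \<phi> w"
    and mass: "\<And>t. t \<in> {0..T} \<Longrightarrow> (\<Sum>k=1..n. integral {0..1} (\<lambda>x. \<bar>w k (x, t)\<bar>)) \<le> N"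
    and j: "j \<in> {1..n}" and x: "x \<in> {0..1}" and t: "t \<in> {0..T}" "1 \<le> \<alpha> * t"
  shows "\<bar>w j (x, t)\<bar> \<le> (residual_const * exp ((M + 1) * T) + real n * (2 * M)) * N"
proof -
  have "\<forall>j\<in>{1..n}. \<exists>wx wt. continuous_on Omega_bar wx \<and> continuous_on Omega_bar wt \<and>
     (\<forall>p\<in>Omega_bar. (w j has_derivative (\<lambda>(h, k). wx p * h + wt p * k)) (at p within Omega_bar))"
    using sol by (auto simp: classical_solution_def C1_Omega_bar_def)
  then obtain wx wt where d: "\<And>j. j \<in> {1..n} \<Longrightarrow> continuous_on Omega_bar (wx j)"
    "\<And>j. j \<in> {1..n} \<Longrightarrow> continuous_on Omega_bar (wt j)"
    "\<And>j p. j \<in> {1..n} \<Longrightarrow> p \<in> Omega_bar \<Longrightarrow> (w j has_derivative (\<lambda>(h, k). wx j p * h + wt j p * k)) (at p within Omega_bar)"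
    by metis
  interpret homogeneous_solution n m a ax b g r \<beta> \<beta>x \<beta>t \<alpha> M T w wx wt N
  proof
    show "wt j (x, t) + a j (x, t) * wx j (x, t) + (\<Sum>k=1..n. b j k (x, t) * w k (x, t))
        + (\<Sum>k=1..n. integral {0..x} (\<lambda>y. g j k (y, t) * w k (y, t))) = 0"
      if "j \<in> {1..n}" "(x, t) \<in> Omega" for j x t
    proof -
      have "deriv (\<lambda>s. w j (x, s)) t + a j (x, t) * deriv (\<lambda>y. w j (y, t)) x + (\<Sum>k=1..n. b j k (x, t) * w k (x, t))
        + (\<Sum>k=1..n. integral {0..x} (\<lambda>y. g j k (y, t) * w k (y, t))) = 0"
        using sol that by (auto simp: classical_solution_def)
      then show ?thesis
        using C1_Omega_bar_partials[OF d(3)[OF that(1)] that(2), THEN DERIV_imp_deriv] by simp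
    qed
    show "w j (inlet j, t) = (\<Sum>k=1..n. integral {0..1} (\<lambda>x. r j k (x, t) * w k (x, t)))"
      if "j \<in> {1..n}" "0 \<le> t" for j t
      using sol that by (auto simp: classical_solution_def inlet_def)
  qed (use d mass in auto)
  show ?thesis by (rule smoothing_estimate[OF j x t])
qed

section \<open>Passage to the limit\<close>

lemma uniform_limit_L2_limit_representative:
  fixes U :: "nat \<Rightarrow> real \<Rightarrow> real" and u v :: "real \<Rightarrow> real"
  assumes U: "\<And>l. continuous_on {0..1} (U l)" and lim: "uniform_limit {0..1} U v sequentially"
    and u: "u \<in> L2_space"
    and L2: "(\<lambda>l. \<integral>x. (u x - U l x)\<^sup>2 \<partial>lebesgue_on {0<..<1}) \<longlonglongrightarrow> 0"
  shows "AE x in lebesgue_on {0<..<1}. u x = v x"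
proof -
  have v: "continuous_on {0..1} v"
    by (rule uniform_limit_theorem[OF _ lim]) (auto simp: U)
  have diff: "(\<lambda>x. u x - v x) \<in> L2_space" "(\<lambda>x. U l x - u x) \<in> L2_space"
      "(\<lambda>x. U l x - v x) \<in> L2_space" for l
    by (intro L2_space_diff u continuous_in_L2_space U v)+
  define I where "I = (\<integral>x. (u x - v x)\<^sup>2 \<partial>lebesgue_on {0<..<1})"
  have "I \<le> e" if e: "0 < e" for e
  proof -
    have "\<forall>\<^sub>F l in sequentially. \<forall>x\<in>{0..1}. dist (U l x) (v x) < sqrt (e / 4)"
      using lim e by (auto simp: uniform_limit_iff)
    moreover have "\<forall>\<^sub>F l in sequentially. (\<integral>x. (u x - U l x)\<^sup>2 \<partial>lebesgue_on {0<..<1}) < e / 4"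
      using order_tendstoD(2)[OF L2, of "e / 4"] e by simp
    ultimately have "\<forall>\<^sub>F l in sequentially. I \<le> e"
    proof eventually_elim
      case (elim l)
      have sq: "(U l x - v x)\<^sup>2 \<le> e / 4" if "x \<in> {0..1}" for x
      proof -
        have "\<bar>U l x - v x\<bar> \<le> sqrt (e / 4)" using elim that by (auto simp: dist_real_def less_imp_le)
        then have "\<bar>U l x - v x\<bar>\<^sup>2 \<le> (sqrt (e / 4))\<^sup>2" by (intro power_mono) auto
        then show ?thesis using e by simp
      qed
      have "(\<integral>x. (U l x - v x)\<^sup>2 \<partial>lebesgue_on {0<..<1}) = integral {0..1} (\<lambda>x. (U l x - v x)\<^sup>2)"
        by (intro lebesgue_on_unit_interval_continuous continuous_intros U v)
      also have "\<dots> \<le> integral {0..1} (\<lambda>x::real. e / 4)"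
        using sq by (intro integral_le integrable_continuous_real continuous_intros U v) auto
      finally have "(\<integral>x. (U l x - v x)\<^sup>2 \<partial>lebesgue_on {0<..<1}) \<le> e / 4" by simp
      moreover have "I \<le> 2 * (\<integral>x. (U l x - u x)\<^sup>2 \<partial>lebesgue_on {0<..<1})
          + 2 * (\<integral>x. (U l x - v x)\<^sup>2 \<partial>lebesgue_on {0<..<1})"
        unfolding I_def by (intro L2_parallelogram_bound diff)
      ultimately show ?case using elim by (simp add: power2_commute[of _ "u _"])
    qed
    then show ?thesis by simp
  qed
  then have "I \<le> 0" by (rule field_le_epsilon[of I 0, simplified])
  moreover have "0 \<le> I" unfolding I_def by simp
  ultimately have "I = 0" by simp
  moreover have "integrable (lebesgue_on {0<..<1}) (\<lambda>x. (u x - v x)\<^sup>2)"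
    using diff(1) by (simp add: L2_space_def)
  ultimately have "AE x in lebesgue_on {0<..<1}. (u x - v x)\<^sup>2 = 0"
    unfolding I_def by (subst (asm) integral_nonneg_eq_0_iff_AE) auto
  then show ?thesis by eventually_elim simp
qed

lemma continuous_on_half_strip:
  fixes v :: "real \<times> real \<Rightarrow> real"
  assumes "\<And>T. continuous_on ({0..1} \<times> {d..T}) v"
  shows "continuous_on ({0..1} \<times> {d..}) v"
  unfolding continuous_on_eq_continuous_within
proof
  fix p :: "real \<times> real"
  assume p: "p \<in> {0..1} \<times> {d..}"
  let ?V = "UNIV \<times> {..<snd p + 1}"
  have "at p within {0..1} \<times> {d..} = at p within {0..1} \<times> {d..snd p + 1}"
    by (rule at_within_nhd[of p ?V]) (auto simp: open_Times mem_Times_iff)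
  moreover have "p \<in> {0..1} \<times> {d..snd p + 1}" using p by (auto simp: mem_Times_iff)
  then have "continuous (at p within {0..1} \<times> {d..snd p + 1}) v"
    using assms[of "snd p + 1"] unfolding continuous_on_eq_continuous_within by blast
  ultimately show "continuous (at p within {0..1} \<times> {d..}) v" by simp
qed

lemma eventual_uniform_cauchy_imp_smoothing:
  assumes u: "\<And>j t. j \<in> {1..n} \<Longrightarrow> 0 \<le> t \<Longrightarrow> u j t \<in> L2_space"
    and U: "\<And>l j. j \<in> {1..n} \<Longrightarrow> continuous_on Omega_bar (U l j)"
    and lim: "\<And>t. 0 \<le> t \<Longrightarrow> (\<lambda>l. L2_norm_vec n (\<lambda>j x. u j t x - U l j (x, t))) \<longlonglongrightarrow> 0"
    and d: "0 < d"
    and cauchy: "\<And>j T. j \<in> {1..n} \<Longrightarrow> d \<le> T \<Longrightarrow> uniformly_Cauchy_on ({0..1} \<times> {d..T}) (\<lambda>l. U l j)"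
  shows "eventually_smoothing n u"
proof -
  define v where "v j p = lim (\<lambda>l. U l j p)" for j p
  have ul: "uniform_limit ({0..1} \<times> {d..T}) (\<lambda>l. U l j) (v j) sequentially" if "j \<in> {1..n}" "d \<le> T" for j T
    unfolding v_def using Cauchy_uniformly_convergent[OF cauchy[OF that]]
    by (simp add: uniformly_convergent_uniform_limit_iff)
  have "continuous_on ({0..1} \<times> {d..}) (v j)" if j: "j \<in> {1..n}" for j
  proof (rule continuous_on_half_strip)
    fix T
    show "continuous_on ({0..1} \<times> {d..T}) (v j)"
    proof (cases "d \<le> T")
      case True
      have "continuous_on ({0..1} \<times> {d..T}) (U l j)" for l
        by (rule continuous_on_subset[OF U[OF j]]) (use d in \<open>auto simp: Omega_bar_def\<close>)
      then show ?thesis by (intro uniform_limit_theorem[OF _ ul[OF j True]]) auto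
    qed auto
  qed
  moreover have "AE x in lebesgue_on {0<..<1}. u j t x = v j (x, t)" if j: "j \<in> {1..n}" and t: "d \<le> t" for j t
  proof (rule uniform_limit_L2_limit_representative[where U="\<lambda>l x. U l j (x, t)"])
    have "continuous_on {0..1} (\<lambda>x. U l j (x, t))" for l
      using continuous_on_Omega_bar_slice[OF U[OF j]] t d by simp
    then show "\<And>l. continuous_on {0..1} (\<lambda>x. U l j (x, t))" .
    show "uniform_limit {0..1} (\<lambda>l x. U l j (x, t)) (\<lambda>x. v j (x, t)) sequentially"
      by (rule uniform_limit_compose'[OF ul[OF j t]]) (use t in auto)
    show "u j t \<in> L2_space" using u[OF j] t d by simp
    have "(\<lambda>l. (L2_norm_vec n (\<lambda>j x. u j t x - U l j (x, t)))\<^sup>2) \<longlonglongrightarrow> 0\<^sup>2"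
      using t d by (intro tendsto_power lim) simp
    then have "(\<lambda>l. (L2_norm_vec n (\<lambda>j x. u j t x - U l j (x, t)))\<^sup>2) \<longlonglongrightarrow> 0"
      by simp
    then show "(\<lambda>l. \<integral>x. (u j t x - U l j (x, t))\<^sup>2 \<partial>lebesgue_on {0<..<1}) \<longlonglongrightarrow> 0"
    proof (rule tendsto_sandwich[OF _ _ tendsto_const, rotated 2])
      show "\<forall>\<^sub>F l in sequentially. (\<integral>x. (u j t x - U l j (x, t))\<^sup>2 \<partial>lebesgue_on {0<..<1})
          \<le> (L2_norm_vec n (\<lambda>j x. u j t x - U l j (x, t)))\<^sup>2"
        by (intro always_eventually allI component_le_L2_norm_vec j)
    qed simp
  qed
  ultimately show ?thesis
    unfolding eventually_smoothing_def using d by blast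
qed

section \<open>Eventual smoothing\<close>

lemma uniformly_positive_lower_bound:
  assumes "finite I" "\<And>i. i \<in> I \<Longrightarrow> (INF p\<in>P. ereal (c i p)) > 0"
  shows "\<exists>\<alpha>>0. \<forall>i\<in>I. \<forall>p\<in>P. \<alpha> \<le> c i p"
  using assms
proof (induction rule: finite_induct)
  case empty
  show ?case by (intro exI[of _ 1]) auto
next
  case (insert i I)
  then obtain \<alpha> where \<alpha>: "\<alpha> > 0" "\<forall>i\<in>I. \<forall>p\<in>P. \<alpha> \<le> c i p" by auto
  obtain \<gamma> :: real where \<gamma>: "0 < ereal \<gamma>" "ereal \<gamma> < (INF p\<in>P. ereal (c i p))"
    using ereal_dense2[of 0 "INF p\<in>P. ereal (c i p)"] insert.prems[of i] by auto
  have "\<gamma> \<le> c i p" if "p \<in> P" for p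
    using INF_lower[OF that, of "\<lambda>p. ereal (c i p)"] \<gamma>(2) by (metis ereal_less_eq(3) less_imp_le order_trans)
  then show ?case using \<alpha> \<gamma>(1) by (intro exI[of _ "min \<alpha> \<gamma>"]) (auto simp: min_le_iff_disj)
qed

theorem theorem1p2:
  fixes n m :: nat
    and a f :: "nat \<Rightarrow> real \<times> real \<Rightarrow> real"
    and b g r :: "nat \<Rightarrow> nat \<Rightarrow> real \<times> real \<Rightarrow> real"
    and \<phi> :: "nat \<Rightarrow> real \<Rightarrow> real"
    and u :: "nat \<Rightarrow> real \<Rightarrow> real \<Rightarrow> real"
    and A :: "(real \<Rightarrow> real) set"
  assumes "n \<ge> 2" and "m \<le> n"
    and "\<forall>j\<in>{1..n}. \<phi> j \<in> L2_space"
    and "\<forall>j\<in>{1..m}. (INF p\<in>Omega_bar. ereal (a j p)) > 0"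
    and "\<forall>j\<in>{m<..n}. (SUP p\<in>Omega_bar. ereal (a j p)) < 0"
    and "\<forall>j\<in>{1..n}. a j \<in> C1_Omega_bar"
    and "\<forall>j\<in>{1..n}. \<forall>k\<in>{1..n}. b j k \<in> C1_Omega_bar"
    and "\<forall>j\<in>{1..n}. \<forall>k\<in>{1..n}. g j k \<in> C01_Omega_bar \<and> r j k \<in> C01_Omega_bar"
    and "\<forall>j\<in>{1..n}. \<forall>k\<in>{1..n}. j \<noteq> k \<longrightarrow>
           (\<exists>\<beta>\<in>C1_Omega_bar. \<forall>p\<in>Omega_bar. b j k p = \<beta> p * (a k p - a j p))"
    and "A \<in> {C0_infinity_01, C_infinity_01}"
    and "L2_generalized_solution A n m a b g r f \<phi> u"
  shows "eventually_smoothing n u"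
proof -
  obtain \<alpha>1 where \<alpha>1: "\<alpha>1 > 0" "\<forall>j\<in>{1..m}. \<forall>p\<in>Omega_bar. \<alpha>1 \<le> a j p"
    using uniformly_positive_lower_bound[of "{1..m}" a Omega_bar] assms(4) by auto
  have "(INF p\<in>Omega_bar. ereal (- a j p)) > 0" if "j \<in> {m<..n}" for j
    using assms(5) that ereal_INF_uminus_eq[of "\<lambda>p. ereal (a j p)" Omega_bar] by (auto simp: ereal_uminus_less_reorder)
  then obtain \<alpha>2 where \<alpha>2: "\<alpha>2 > 0" "\<forall>j\<in>{m<..n}. \<forall>p\<in>Omega_bar. \<alpha>2 \<le> - a j p"
    using uniformly_positive_lower_bound[of "{m<..n}" "\<lambda>j p. - a j p" Omega_bar] by auto
  \<comment> \<open>A common lower bound for all speeds on the whole half-strip; it fixes the smoothing time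
    \<open>1 / \<alpha>\<close> once and for all, whereas the bound M below is chosen anew for every T.\<close>
  define \<alpha> where "\<alpha> = min \<alpha>1 \<alpha>2"
  have \<alpha>: "0 < \<alpha>" "\<And>j p. j \<in> {1..m} \<Longrightarrow> p \<in> Omega_bar \<Longrightarrow> \<alpha> \<le> a j p"
    "\<And>j p. j \<in> {m<..n} \<Longrightarrow> p \<in> Omega_bar \<Longrightarrow> a j p \<le> - \<alpha>"
    using \<alpha>1 \<alpha>2 by (fastforce simp: \<alpha>_def)+

  have "\<forall>j\<in>{1..n}. \<exists>ax dt. continuous_on Omega_bar ax \<and> continuous_on Omega_bar dt \<and>
     (\<forall>p\<in>Omega_bar. (a j has_derivative (\<lambda>(h, k). ax p * h + dt p * k)) (at p within Omega_bar))"
    using assms(6) by (auto simp: C1_Omega_bar_def)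
  then obtain ax dt where ax: "\<And>j. j \<in> {1..n} \<Longrightarrow> continuous_on Omega_bar (ax j)"
    "\<And>j p. j \<in> {1..n} \<Longrightarrow> p \<in> Omega_bar \<Longrightarrow>
      (a j has_derivative (\<lambda>(h, k). ax j p * h + dt j p * k)) (at p within Omega_bar)"
    by metis
  have "\<forall>j\<in>{1..n}. \<forall>k\<in>{1..n}. \<exists>\<beta> \<beta>x \<beta>t. j \<noteq> k \<longrightarrow>
      \<beta> \<in> C1_Omega_bar \<and> (\<forall>p\<in>Omega_bar. b j k p = \<beta> p * (a k p - a j p)) \<and>
      continuous_on Omega_bar \<beta>x \<and> continuous_on Omega_bar \<beta>t \<and>
      (\<forall>p\<in>Omega_bar. (\<beta> has_derivative (\<lambda>(h, s). \<beta>x p * h + \<beta>t p * s)) (at p within Omega_bar))"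
    using assms(9) unfolding C1_Omega_bar_def by blast
  then obtain \<beta> \<beta>x \<beta>t where \<beta>': "\<forall>j\<in>{1..n}. \<forall>k\<in>{1..n}. j \<noteq> k \<longrightarrow>
      \<beta> j k \<in> C1_Omega_bar \<and> (\<forall>p\<in>Omega_bar. b j k p = \<beta> j k p * (a k p - a j p)) \<and>
      continuous_on Omega_bar (\<beta>x j k) \<and> continuous_on Omega_bar (\<beta>t j k) \<and>
      (\<forall>p\<in>Omega_bar. (\<beta> j k has_derivative (\<lambda>(h, s). \<beta>x j k p * h + \<beta>t j k p * s)) (at p within Omega_bar))"
    by metis
  then have \<beta>: "\<And>j k. j \<in> {1..n} \<Longrightarrow> k \<in> {1..n} \<Longrightarrow> j \<noteq> k \<Longrightarrow> continuous_on Omega_bar (\<beta> j k)"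
    "\<And>j k. j \<in> {1..n} \<Longrightarrow> k \<in> {1..n} \<Longrightarrow> j \<noteq> k \<Longrightarrow> continuous_on Omega_bar (\<beta>x j k)"
    "\<And>j k. j \<in> {1..n} \<Longrightarrow> k \<in> {1..n} \<Longrightarrow> j \<noteq> k \<Longrightarrow> continuous_on Omega_bar (\<beta>t j k)"
    "\<And>j k p. j \<in> {1..n} \<Longrightarrow> k \<in> {1..n} \<Longrightarrow> j \<noteq> k \<Longrightarrow> p \<in> Omega_bar \<Longrightarrow>
      (\<beta> j k has_derivative (\<lambda>(h, s). \<beta>x j k p * h + \<beta>t j k p * s)) (at p within Omega_bar)"
    "\<And>j k p. j \<in> {1..n} \<Longrightarrow> k \<in> {1..n} \<Longrightarrow> j \<noteq> k \<Longrightarrow> p \<in> Omega_bar \<Longrightarrow> b j k p = \<beta> j k p * (a k p - a j p)"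
    by (auto intro: C1_Omega_bar_continuous)
  have a_cont: "continuous_on Omega_bar (a j)" if "j \<in> {1..n}" for j
    using assms(6) that by (auto intro: C1_Omega_bar_continuous)
  have bgr_cont: "continuous_on Omega_bar (b j k)" "continuous_on Omega_bar (g j k)" "continuous_on Omega_bar (r j k)"
    if "j \<in> {1..n}" "k \<in> {1..n}" for j k
    using assms(7,8) that by (auto intro: C1_Omega_bar_continuous simp: C01_Omega_bar_def)

  have system: "\<exists>M. transport_system n m a ax b g r \<beta> \<beta>x \<beta>t \<alpha> M T" if T: "0 < T" for T
  proof -
    define off where "off = {(j, k) \<in> {1..n} \<times> {1..n}. j \<noteq> k}"
    define F where "F = a ` {1..n} \<union> ax ` {1..n} \<union> (\<Union>c\<in>{b, g, r}. case_prod c ` ({1..n} \<times> {1..n}))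
      \<union> (\<Union>c\<in>{\<beta>, \<beta>x, \<beta>t}. case_prod c ` off)"
    have "finite off" unfolding off_def by (rule finite_subset[of _ "{1..n} \<times> {1..n}"]) auto
    then have "finite F" by (simp add: F_def)
    moreover have "continuous_on Omega_bar v" if "v \<in> F" for v
      using that a_cont ax(1) bgr_cont \<beta>(1-3) by (auto simp: F_def off_def)
    ultimately obtain M where M: "\<And>v p. v \<in> F \<Longrightarrow> p \<in> {0..1} \<times> {0..T} \<Longrightarrow> \<bar>v p\<bar> \<le> M"
      using common_bound_on_slab[of F T] by blast
    have "transport_system n m a ax b g r \<beta> \<beta>x \<beta>t \<alpha> M T"
    proof
      show "((\<lambda>y. a j (y, t)) has_real_derivative ax j (x, t)) (at x within {0..1})"
        if "j \<in> {1..n}" "(x, t) \<in> Omega_bar" for j x t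
        by (rule has_derivative_Omega_bar_slices(1)[OF ax(2)]) (use that in auto)
      show "\<bar>a j p\<bar> \<le> M \<and> \<bar>ax j p\<bar> \<le> M" if "j \<in> {1..n}" "p \<in> {0..1} \<times> {0..T}" for j p
        using that by (intro conjI M) (auto simp: F_def)
      show "\<bar>b j k p\<bar> \<le> M \<and> \<bar>g j k p\<bar> \<le> M \<and> \<bar>r j k p\<bar> \<le> M"
        if "j \<in> {1..n}" "k \<in> {1..n}" "p \<in> {0..1} \<times> {0..T}" for j k p
        using that by (intro conjI M) (force simp: F_def)+
      show "\<bar>\<beta> j k p\<bar> \<le> M \<and> \<bar>\<beta>x j k p\<bar> \<le> M \<and> \<bar>\<beta>t j k p\<bar> \<le> M"
        if "j \<in> {1..n}" "k \<in> {1..n}" "j \<noteq> k" "p \<in> {0..1} \<times> {0..T}" for j k p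
        using that by (intro conjI M) (force simp: F_def off_def)+
    qed (fact assms(2) T \<alpha> a_cont ax(1) bgr_cont \<beta>(4,5))+
    then show ?thesis ..
  qed

  obtain \<Phi> U where U: "\<And>l. classical_solution n m a b g r f (\<Phi> l) (U l)"
    and conv: "\<And>t. 0 < t \<Longrightarrow> uniform_limit {0..t} (\<lambda>l \<theta>. L2_norm_vec n (\<lambda>j x. u j \<theta> x - U l j (x, \<theta>)))
                 (\<lambda>_. 0) sequentially"
    using assms(11) unfolding L2_generalized_solution_def by blast
  have u: "u j t \<in> L2_space" if "j \<in> {1..n}" "0 \<le> t" for j t
    using assms(11) that by (auto simp: L2_generalized_solution_def C_L2_vec_def)
  have U_cont: "continuous_on Omega_bar (U l j)" if "j \<in> {1..n}" for l j
    using U[of l] that by (auto simp: classical_solution_def intro: C1_Omega_bar_continuous)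
  show ?thesis
  proof (rule eventual_uniform_cauchy_imp_smoothing[where U=U and d="1 / \<alpha>"])
    show "(\<lambda>l. L2_norm_vec n (\<lambda>j x. u j t x - U l j (x, t))) \<longlonglongrightarrow> 0" if "0 \<le> t" for t
      using tendsto_uniform_limitI[OF conv[of "t + 1"], of t] that by simp
    show "uniformly_Cauchy_on ({0..1} \<times> {1 / \<alpha>..T}) (\<lambda>l. U l j)" if j: "j \<in> {1..n}" and T: "1 / \<alpha> \<le> T" for j T
    proof (rule uniformly_Cauchy_onI)
      fix e :: real assume e: "0 < e"
      have T0: "0 < T" using T \<alpha>(1) by (meson less_le_trans zero_less_divide_1_iff)
      obtain M where "transport_system n m a ax b g r \<beta> \<beta>x \<beta>t \<alpha> M T" using system[OF T0] by blast
      then interpret transport_system n m a ax b g r \<beta> \<beta>x \<beta>t \<alpha> M T .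
      define C where "C = \<bar>residual_const * exp ((M + 1) * T) + real n * (2 * M)\<bar> + 1"
      \<comment> \<open>The mass of the difference of two approximations is at most \<open>2 * n * \<epsilon>\<close>; the additional 1
        keeps the denominator positive and the final inequality strict.\<close>
      define \<epsilon> where "\<epsilon> = e / (C * (2 * real n + 1))"
      have C: "0 < C" by (simp add: C_def)
      then have \<epsilon>: "0 < \<epsilon>" using e by (simp add: \<epsilon>_def)
      obtain L where L': "\<forall>l\<ge>L. \<forall>\<theta>\<in>{0..T}. dist (L2_norm_vec n (\<lambda>j x. u j \<theta> x - U l j (x, \<theta>))) 0 < \<epsilon>"
        using uniform_limitD[OF conv[OF T0] \<epsilon>] unfolding eventually_sequentially by blast
      have L: "L2_norm_vec n (\<lambda>j x. u j \<theta> x - U l j (x, \<theta>)) \<le> \<epsilon>" if "L \<le> l" "\<theta> \<in> {0..T}" for l \<theta>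
        using L'[rule_format, OF that] by (auto simp: dist_real_def)
      have "dist (U l j (x, t)) (U l' j (x, t)) < e"
        if l: "L \<le> l" "L \<le> l'" and x: "x \<in> {0..1}" and t: "t \<in> {1 / \<alpha>..T}" for l l' x t
      proof -
        have t': "t \<in> {0..T}" "1 \<le> \<alpha> * t"
          using t \<alpha>(1) by (auto simp: divide_le_eq mult.commute intro: order_trans[of 0 "1 / \<alpha>"])
        have "(\<Sum>k=1..n. integral {0..1} (\<lambda>x. \<bar>U l k (x, \<theta>) - U l' k (x, \<theta>)\<bar>)) \<le> real n * (2 * \<epsilon>)"
          if \<theta>: "\<theta> \<in> {0..T}" for \<theta>
        proof -
          have slice: "continuous_on {0..1} (\<lambda>x. U i k (x, \<theta>))" if "k \<in> {1..n}" for i k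
            using continuous_on_Omega_bar_slice[OF U_cont[OF that]] \<theta> by simp
          have "(\<Sum>k=1..n. integral {0..1} (\<lambda>x. \<bar>U l k (x, \<theta>) - U l' k (x, \<theta>)\<bar>))
              \<le> real n * L2_norm_vec n (\<lambda>k x. U l k (x, \<theta>) - U l' k (x, \<theta>))"
            by (intro mass_le_L2_norm_vec continuous_intros slice)
          also have "\<dots> \<le> real n * (2 * \<epsilon>)"
            by (intro mult_left_mono L2_norm_vec_diff_le[where u="\<lambda>j. u j \<theta>"] continuous_in_L2_space slice u L)
              (use \<theta> l in auto)
          finally show ?thesis .
        qed
        then have "\<bar>U l j (x, t) - U l' j (x, t)\<bar> \<le> (residual_const * exp ((M + 1) * T) + real n * (2 * M)) * (real n * (2 * \<epsilon>))"
          by (intro classical_solution_smoothing[OF classical_solutions_difference[OF U U]] mn g_cont r_cont j x t')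
        also have "\<dots> \<le> C * (real n * (2 * \<epsilon>))"
          using \<epsilon> by (intro mult_right_mono) (auto simp: C_def)
        also have "\<dots> < C * (2 * real n + 1) * \<epsilon>"
          using C \<epsilon> by (simp add: algebra_simps)
        also have "\<dots> = e" using C by (simp add: \<epsilon>_def)
        finally show ?thesis by (simp add: dist_real_def)
      qed
      then show "\<exists>L. \<forall>p\<in>{0..1} \<times> {1 / \<alpha>..T}. \<forall>l\<ge>L. \<forall>l'\<ge>L. dist (U l j p) (U l' j p) < e"
        by (intro exI[of _ L]) auto
    qed
  qed (use u U_cont \<alpha>(1) in auto)
qed

end
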